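(* Let $\phi\colon\Gamma\to X$ be a partial flow on a metric space $X$ and let $\Lambda\subset X$ be an isolated set of $\phi$. Then $\Lambda$ admits an isolating universe: a flow $\psi$ on a compact metric space $Y$ as in the context, with the properties (1)–(4) listed there. Moreover, this isolating universe can be chosen so that, for $\psi$, the set $\Lambda_\alpha=\{\alpha\}\cup\Lambda\cup W^s(\Lambda)$ is a repeller, the set $\Lambda_\omega=\{\omega\}\cup\Lambda\cup W^u(\Lambda)$ is an attractor, and $\Lambda=\Lambda_\alpha\cap\Lambda_\omega$.
   Context: A partial flow on a metric space $X$ is a continuous map $\phi\colon\Gamma\to X$, $(t,x)\mapsto\phi_t(x)$, where $\Gamma\subset\mathbb{R}\times X$ is open. It is required to satisfy the following: (i) for every $x$ the set $\Gamma_x=\{t:(t,x)\in\Gamma\}$ is connected; (ii) $0\in\Gamma_x$ and $\Gamma_{\phi_t(x)}=\Gamma_x-t$ for $(t,x)\in\Gamma$; (iii) $\phi_0(x)=x$ and $\phi_s(\phi_t(x))=\phi_{s+t}(x)$ whenever $s,t,s+t\in\Gamma_x$. A flow is a partial flow with $\Gamma=\mathbb{R}\times X$. A set $\Lambda$ is $\phi$-invariant if $x\in\Lambda$ and $t\in\Gamma_x$ imply $\phi_t(x)\in\Lambda$. A $\phi$-invariant set $\Lambda$ is an isolated set if there is a compact neighborhood $N$ of $\Lambda$ (an isolating neighborhood) such that $\phi_{\Gamma_x}(x)\subseteq N$ implies $x\in\Lambda$. An isolated set $\Lambda$ is an attractor if it has an isolating neighborhood $N$ such that every $x\in N\setminus\Lambda$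 satisfies $\phi_t(x)\notin N$ for some $t<0$. It is a repeller if it is an attractor for the time-reversed flow. Given an isolated set $\Lambda$ with isolating neighborhood $N$, a flow $\psi$ on a compact metric space $Y$ is an isolating universe of $\Lambda$ if the following hold. (1) There is a homeomorphism $h\colon N\to M\subset Y$ conjugating $\phi$ restricted to $N$ with $\psi$ restricted to $M$, i.e. $h(\phi_t(x))=\psi_t(h(x))$ whenever $\phi_s(x)\in N$ for all $s$ between $0$ and $t$. Via $h$ one identifies $N$ with $M$ and $\Lambda$ with $h(\Lambda)$. (2) There are two fixed points $\alpha\neq\omega$ of $\psi$ not in $M$. (3) For every $x\neq\alpha$, $\psi_t(x)$ converges as $t\to+\infty$ either to $h(\Lambda)$ or to $\omega$. (4) For every $x\neq\omega$, $\psi_t(x)$ converges as $t\to-\infty$ either to $h(\Lambda)$ or to $\alpha$. Finally, $W^s(\Lambda)=\{x\in Y:\operatorname{dist}(\psi_t(x),\Lambda)\to0 \text{ as } t\to+\infty\}$ and $W^u(\Lambda)=\{x\in Y:\operatorname{dist}(\psi_t(x),\Lambda)\to0 \text{ as } t\to-\infty\}$. *)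

theory Defs
  imports "HOL-Analysis.Analysis"
begin

definition dom_at :: "(real \<times> 'a) set \<Rightarrow> 'a \<Rightarrow> real set" where
  "dom_at \<Gamma> x = {t. (t, x) \<in> \<Gamma>}"

definition partial_flow :: "'a::metric_space set \<Rightarrow> (real \<times> 'a) set \<Rightarrow> (real \<Rightarrow> 'a \<Rightarrow> 'a) \<Rightarrow> bool" where
  "partial_flow X \<Gamma> \<phi> \<longleftrightarrow>
     \<Gamma> \<subseteq> UNIV \<times> X \<and>
     openin (top_of_set (UNIV \<times> X)) \<Gamma> \<and>
     continuous_on \<Gamma> (\<lambda>(t, x). \<phi> t x) \<and>
     (\<forall>(t, x) \<in> \<Gamma>. \<phi> t x \<in> X) \<and>
     (\<forall>x \<in> X. connected (dom_at \<Gamma> x)) \<and>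
     (\<forall>x \<in> X. 0 \<in> dom_at \<Gamma> x) \<and>
     (\<forall>(t, x) \<in> \<Gamma>. dom_at \<Gamma> (\<phi> t x) = (\<lambda>s. s - t) ` dom_at \<Gamma> x) \<and>
     (\<forall>x \<in> X. \<phi> 0 x = x) \<and>
     (\<forall>x \<in> X. \<forall>s t. s \<in> dom_at \<Gamma> x \<and> t \<in> dom_at \<Gamma> x \<and> s + t \<in> dom_at \<Gamma> x
        \<longrightarrow> \<phi> s (\<phi> t x) = \<phi> (s + t) x)"

definition is_flow :: "'a::metric_space set \<Rightarrow> (real \<Rightarrow> 'a \<Rightarrow> 'a) \<Rightarrow> bool" where
  "is_flow Y \<psi> \<longleftrightarrow> partial_flow Y (UNIV \<times> Y) \<psi>"

definition invariant_set :: "'a set \<Rightarrow> (real \<times> 'a) set \<Rightarrow> (real \<Rightarrow> 'a \<Rightarrow> 'a) \<Rightarrow> 'a set \<Rightarrow> bool" where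
  "invariant_set X \<Gamma> \<phi> L \<longleftrightarrow> L \<subseteq> X \<and> (\<forall>x \<in> L. \<forall>t \<in> dom_at \<Gamma> x. \<phi> t x \<in> L)"

definition isolating_nbhd :: "'a::metric_space set \<Rightarrow> (real \<times> 'a) set \<Rightarrow> (real \<Rightarrow> 'a \<Rightarrow> 'a) \<Rightarrow> 'a set \<Rightarrow> 'a set \<Rightarrow> bool" where
  "isolating_nbhd X \<Gamma> \<phi> L N \<longleftrightarrow>
     N \<subseteq> X \<and> compact N \<and> (\<exists>U. openin (top_of_set X) U \<and> L \<subseteq> U \<and> U \<subseteq> N) \<and>
     (\<forall>x \<in> X. (\<forall>t \<in> dom_at \<Gamma> x. \<phi> t x \<in> N) \<longrightarrow> x \<in> L)"

definition isolated_set :: "'a::metric_space set \<Rightarrow> (real \<times> 'a) set \<Rightarrow> (real \<Rightarrow> 'a \<Rightarrow> 'a) \<Rightarrow> 'a set \<Rightarrow> bool" where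
  "isolated_set X \<Gamma> \<phi> L \<longleftrightarrow> invariant_set X \<Gamma> \<phi> L \<and> (\<exists>N. isolating_nbhd X \<Gamma> \<phi> L N)"

definition attractor :: "'a::metric_space set \<Rightarrow> (real \<times> 'a) set \<Rightarrow> (real \<Rightarrow> 'a \<Rightarrow> 'a) \<Rightarrow> 'a set \<Rightarrow> bool" where
  "attractor X \<Gamma> \<phi> L \<longleftrightarrow> invariant_set X \<Gamma> \<phi> L \<and>
     (\<exists>N. isolating_nbhd X \<Gamma> \<phi> L N \<and>
          (\<forall>x \<in> N - L. \<exists>t \<in> dom_at \<Gamma> x. t < 0 \<and> \<phi> t x \<notin> N))"

definition rev_dom :: "(real \<times> 'a) set \<Rightarrow> (real \<times> 'a) set" where
  "rev_dom \<Gamma> = {(- t, x) | t x. (t, x) \<in> \<Gamma>}"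

definition rev_flow :: "(real \<Rightarrow> 'a \<Rightarrow> 'a) \<Rightarrow> real \<Rightarrow> 'a \<Rightarrow> 'a" where
  "rev_flow \<phi> t x = \<phi> (- t) x"

definition repeller :: "'a::metric_space set \<Rightarrow> (real \<times> 'a) set \<Rightarrow> (real \<Rightarrow> 'a \<Rightarrow> 'a) \<Rightarrow> 'a set \<Rightarrow> bool" where
  "repeller X \<Gamma> \<phi> L \<longleftrightarrow> attractor X (rev_dom \<Gamma>) (rev_flow \<phi>) L"

text \<open>dist (f t) A \<rightarrow> 0 along filter F (false when A is empty, as it should be).\<close>
definition tends_to_set :: "(real \<Rightarrow> 'a::metric_space) \<Rightarrow> 'a set \<Rightarrow> real filter \<Rightarrow> bool" where
  "tends_to_set f A F \<longleftrightarrow> (\<forall>e > 0. eventually (\<lambda>t. \<exists>y \<in> A. dist (f t) y < e) F)"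

definition stable_set :: "'a::metric_space set \<Rightarrow> (real \<Rightarrow> 'a \<Rightarrow> 'a) \<Rightarrow> 'a set \<Rightarrow> 'a set" where
  "stable_set Y \<psi> L = {x \<in> Y. tends_to_set (\<lambda>t. \<psi> t x) L at_top}"

definition unstable_set :: "'a::metric_space set \<Rightarrow> (real \<Rightarrow> 'a \<Rightarrow> 'a) \<Rightarrow> 'a set \<Rightarrow> 'a set" where
  "unstable_set Y \<psi> L = {x \<in> Y. tends_to_set (\<lambda>t. \<psi> t x) L at_bot}"

text \<open>Isolating universe (conditions (1)-(4)) for the isolated set L with isolating
  neighbourhood N; the compact metric space Y is a compact subset of the metric space
  nat => real (product topology), into which every compact metric space embeds.\<close>
definition isolating_universe ::
  "'a::metric_space set \<Rightarrow> (real \<times> 'a) set \<Rightarrow> (real \<Rightarrow> 'a \<Rightarrow> 'a) \<Rightarrow> 'a set \<Rightarrow> 'a set \<Rightarrow>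
   'b::metric_space set \<Rightarrow> (real \<Rightarrow> 'b \<Rightarrow> 'b) \<Rightarrow> ('a \<Rightarrow> 'b) \<Rightarrow> 'b \<Rightarrow> 'b \<Rightarrow> bool" where
  "isolating_universe X \<Gamma> \<phi> L N Y \<psi> h \<alpha> \<omega> \<longleftrightarrow>
     compact Y \<and> is_flow Y \<psi> \<and>
     h ` N \<subseteq> Y \<and> (\<exists>g. homeomorphism N (h ` N) h g) \<and>
     (\<forall>x \<in> N. \<forall>t. ({min 0 t..max 0 t} \<subseteq> dom_at \<Gamma> x \<and>
                     (\<forall>s \<in> {min 0 t..max 0 t}. \<phi> s x \<in> N))
                   \<longrightarrow> h (\<phi> t x) = \<psi> t (h x)) \<and>
     \<alpha> \<in> Y \<and> \<omega> \<in> Y \<and> \<alpha> \<noteq> \<omega> \<and> \<alpha> \<notin> h ` N \<and> \<omega> \<notin> h ` N \<and>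
     (\<forall>t. \<psi> t \<alpha> = \<alpha>) \<and> (\<forall>t. \<psi> t \<omega> = \<omega>) \<and>
     (\<forall>y \<in> Y. y \<noteq> \<alpha> \<longrightarrow>
        tends_to_set (\<lambda>t. \<psi> t y) (h ` L) at_top \<or> ((\<lambda>t. \<psi> t y) \<longlongrightarrow> \<omega>) at_top) \<and>
     (\<forall>y \<in> Y. y \<noteq> \<omega> \<longrightarrow>
        tends_to_set (\<lambda>t. \<psi> t y) (h ` L) at_bot \<or> ((\<lambda>t. \<psi> t y) \<longlongrightarrow> \<alpha>) at_bot)"

end

theory Submission
  imports Defs
begin

text \<open>
  Fix an isolating neighbourhood \<open>K\<close> of \<open>\<Lambda>\<close>. The points of the universe are the orbit segments of
  \<open>\<phi>\<close> contained in \<open>K\<close>, each with an entry time \<open>a\<close> and an exit time \<open>b\<close> in \<open>[-\<infinity>, \<infinity>]\<close>, and \<open>\<psi>\<close>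
  translates time. A segment that recedes into the future (\<open>a = b = \<infinity>\<close>) is collapsed to \<open>\<alpha>\<close>, one
  that recedes into the past (\<open>a = b = -\<infinity>\<close>) to \<open>\<omega>\<close>. Limits of orbit segments in the compact set
  \<open>K\<close> are orbit segments in \<open>K\<close>, so the universe is compact. If \<open>b < \<infinity>\<close> then a point tends to \<open>\<omega>\<close>
  in forward time, otherwise its limits are complete orbits in \<open>K\<close> and so lie in \<open>\<Lambda>\<close>. The sets
  \<open>\<Lambda>\<^sub>\<alpha>\<close> and \<open>\<Lambda>\<^sub>\<omega>\<close> are \<open>{b = \<infinity>}\<close> and \<open>{a = -\<infinity>}\<close>, with isolating neighbourhoods \<open>{b \<ge> 0}\<close> and
  \<open>{a \<le> 0}\<close>. A smaller neighbourhood \<open>N\<close> embeds by sending \<open>x\<close> to its orbit segment between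
  continuously regularised entry and exit times.
\<close>

section \<open>Extended time\<close>

text \<open>An order isomorphism of [-\<infinity>, \<infinity>] onto [-1, 1]; it turns entry and
  exit times into real coordinates.\<close>

definition squash :: "ereal \<Rightarrow> real" where
  "squash e = (case e of ereal r \<Rightarrow> r / (1 + \<bar>r\<bar>) | PInfty \<Rightarrow> 1 | MInfty \<Rightarrow> -1)"

lemma squash_simps [simp]:
  "squash (ereal r) = r / (1 + \<bar>r\<bar>)" "squash \<infinity> = 1" "squash (-\<infinity>) = -1"
  by (simp_all add: squash_def flip: MInfty_eq_minfinity infinity_ereal_def)

lemma squash_0 [simp]: "squash 0 = 0"
  by (metis div_0 squash_simps(1) zero_ereal_def)

lemma squash_less:
  assumes "x < y" shows "squash x < squash y"
proof -
  have "r / (1 + \<bar>r\<bar>) < s / (1 + \<bar>s\<bar>)" if "r < s" for r s :: real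
  proof -
    consider "0 \<le> r" | "r < 0" "0 \<le> s" | "s < 0" by linarith
    then show ?thesis
    proof cases
      case 2
      then have "r / (1 + \<bar>r\<bar>) < 0" "0 \<le> s / (1 + \<bar>s\<bar>)" by (simp_all add: divide_neg_pos)
      then show ?thesis by linarith
    qed (use that in \<open>simp_all add: field_simps\<close>)
  qed
  moreover have "r / (1 + \<bar>r\<bar>) < 1" "- 1 < r / (1 + \<bar>r\<bar>)" for r :: real
    by (simp_all add: field_simps abs_if)
  ultimately show ?thesis using assms by (cases x; cases y) auto
qed

lemma squash_less_iff [simp]: "squash x < squash y \<longleftrightarrow> x < y"
  by (metis less_asym linorder_neqE squash_less)

lemma squash_eq_iff [simp]: "squash x = squash y \<longleftrightarrow> x = y"
  by (metis less_irrefl linorder_neqE squash_less)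

lemma abs_squash_le: "\<bar>squash x\<bar> \<le> 1"
  by (cases x) (auto simp: field_simps)

lemma abs_squash_eq_1_iff: "\<bar>squash x\<bar> = 1 \<longleftrightarrow> x = \<infinity> \<or> x = -\<infinity>"
  by (cases x) (auto simp: field_simps)

lemma squash_surj:
  assumes "\<bar>u\<bar> \<le> 1" shows "\<exists>x. squash x = u"
proof -
  consider "u = 1" | "u = -1" | "\<bar>u\<bar> < 1" using assms by linarith
  then show ?thesis
  proof cases
    case 3
    then have "1 + \<bar>u / (1 - \<bar>u\<bar>)\<bar> = 1 / (1 - \<bar>u\<bar>)"
      by (simp add: abs_divide field_simps)
    then have "squash (ereal (u / (1 - \<bar>u\<bar>))) = u"
      using 3 by simp
    then show ?thesis ..
  qed (metis squash_simps)+
qed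

text \<open>A strictly increasing surjection is continuous for the order topologies: bounds in
  [-1, 1] pull back to bounds in \<open>ereal\<close>.\<close>

lemma tendsto_squash:
  assumes "(f \<longlongrightarrow> x) F" shows "((\<lambda>i. squash (f i)) \<longlongrightarrow> squash x) F"
proof (rule order_tendstoI)
  fix u assume u: "u < squash x"
  show "\<forall>\<^sub>F i in F. u < squash (f i)"
  proof (cases "u < -1")
    case True
    have "u < squash z" for z using True abs_squash_le[of z] by linarith
    then show ?thesis by simp
  next
    case False
    then have "\<bar>u\<bar> \<le> 1" using u abs_squash_le[of x] by linarith
    then obtain v where "squash v = u"
      using squash_surj by blast
    then show ?thesis using u order_tendstoD(1)[OF assms, of v] by auto
  qed
next
  fix u assume u: "squash x < u"
  show "\<forall>\<^sub>F i in F. squash (f i) < u"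
  proof (cases "u > 1")
    case True
    have "squash z < u" for z using True abs_squash_le[of z] by linarith
    then show ?thesis by simp
  next
    case False
    then have "\<bar>u\<bar> \<le> 1" using u abs_squash_le[of x] by linarith
    then obtain v where "squash v = u"
      using squash_surj by blast
    then show ?thesis using u order_tendstoD(2)[OF assms, of v] by auto
  qed
qed

section \<open>Coordinates in the product space\<close>

lemma tendsto_fun_componentwise:
  fixes f :: "'i \<Rightarrow> 'a \<Rightarrow> 'b::topological_space"
  assumes "\<And>k. ((\<lambda>i. f i k) \<longlongrightarrow> l k) F"
  shows "(f \<longlongrightarrow> l) F"
proof -
  have "limitin (product_topology (\<lambda>_. euclidean) UNIV) f l F"
    using assms by (auto simp: limitin_componentwise)
  then show ?thesis by (simp add: euclidean_product_topology)
qed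

text \<open>Finite nets of mesh 1/(n+1) together form a countable set whose closure contains
  \<open>K\<close>, and distances to it determine a point of \<open>K\<close>. They supply the
  spatial coordinates of the universe.\<close>

lemma countable_separating_points:
  fixes K :: "'a::metric_space set"
  assumes "compact K"
  obtains q :: "nat \<Rightarrow> 'a" where
    "\<And>x y. x \<in> K \<Longrightarrow> y \<in> K \<Longrightarrow> (\<And>k. dist x (q k) = dist y (q k)) \<Longrightarrow> x = y"
proof -
  have "\<forall>n. \<exists>k. finite k \<and> K \<subseteq> (\<Union>x\<in>k. ball x (inverse (Suc n)))"
    using assms unfolding compact_eq_totally_bounded by simp
  then obtain C where C: "\<And>n. finite (C n)" "\<And>n. K \<subseteq> (\<Union>x\<in>C n. ball x (inverse (Suc n)))"
    by metis
  let ?D = "\<Union>n. C n"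
  have cD: "countable ?D" using C(1) by (simp add: countable_finite)
  have "x = y" if x: "x \<in> K" and y: "y \<in> K"
    and eq: "\<And>k. dist x (from_nat_into ?D k) = dist y (from_nat_into ?D k)" for x y
  proof -
    have "dist x y \<le> 0 + e" if "e > 0" for e
    proof -
      obtain n where n: "inverse (real (Suc n)) < e/2" using reals_Archimedean[of "e/2"] \<open>e>0\<close> by auto
      obtain z where z: "z \<in> C n" "dist z x < inverse (Suc n)" using C(2)[of n] x by auto
      then have "z \<in> ?D" by auto
      then obtain k where "from_nat_into ?D k = z" using from_nat_into_surj[OF cD] by blast
      then have "dist x z = dist y z" using eq by blast
      then show ?thesis using z n dist_triangle3[of x y z] by (simp add: dist_commute)
    qed
    then show ?thesis using field_le_epsilon[of "dist x y" 0] by simp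
  qed
  then show ?thesis using that by blast
qed

section \<open>Clamping a time to an interval\<close>

definition clamp_time :: "ereal \<Rightarrow> ereal \<Rightarrow> real \<Rightarrow> real" where
  "clamp_time a b t = real_of_ereal (max a (min b (ereal t)))"

lemma ereal_clamp_time:
  assumes "a \<noteq> \<infinity>" "b \<noteq> -\<infinity>"
  shows "ereal (clamp_time a b t) = max a (min b (ereal t))"
  using assms by (cases a; cases b) (auto simp: clamp_time_def max_def min_def)

lemma clamp_time_bounds:
  assumes "a \<noteq> \<infinity>" "b \<noteq> -\<infinity>" "a \<le> b"
  shows "a \<le> ereal (clamp_time a b t)" "ereal (clamp_time a b t) \<le> b"
  using assms by (auto simp: ereal_clamp_time)

lemma clamp_time_id: "a \<le> ereal t \<Longrightarrow> ereal t \<le> b \<Longrightarrow> clamp_time a b t = t"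
  by (simp add: clamp_time_def max_def min_def)

lemma clamp_time_shift:
  assumes "a \<noteq> \<infinity>" "b \<noteq> -\<infinity>"
  shows "clamp_time (a - ereal t) (b - ereal t) s = clamp_time a b (s + t) - t"
  using assms by (cases a; cases b) (auto simp: clamp_time_def max_def min_def)

lemma tendsto_clamp_time:
  assumes "(f \<longlongrightarrow> a) F" "(g \<longlongrightarrow> b) F" "(u \<longlongrightarrow> t) F" "a \<noteq> \<infinity>" "b \<noteq> -\<infinity>"
  shows "((\<lambda>i. clamp_time (f i) (g i) (u i)) \<longlongrightarrow> clamp_time a b t) F"
proof -
  have "((\<lambda>i. max (f i) (min (g i) (ereal (u i)))) \<longlongrightarrow> ereal (clamp_time a b t)) F"
    unfolding ereal_clamp_time[OF assms(4,5)]
    by (intro tendsto_max tendsto_min assms tendsto_ereal)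
  then show ?thesis unfolding clamp_time_def[of "f _"]
    by (rule lim_real_of_ereal)
qed

section \<open>Partial flows near an isolated set\<close>

locale isolated_system =
  fixes X :: "'a::metric_space set" and \<Gamma> :: "(real \<times> 'a) set"
    and \<phi> :: "real \<Rightarrow> 'a \<Rightarrow> 'a" and L K :: "'a set"
  assumes pflow: "partial_flow X \<Gamma> \<phi>"
    and inv: "invariant_set X \<Gamma> \<phi> L"
    and isol: "isolating_nbhd X \<Gamma> \<phi> L K"
begin

section \<open>Basic properties of the partial flow\<close>

lemma dom_iff: "t \<in> dom_at \<Gamma> x \<longleftrightarrow> (t, x) \<in> \<Gamma>"
  by (simp add: dom_at_def)

lemma dom_subset: "(t, x) \<in> \<Gamma> \<Longrightarrow> x \<in> X"
  using pflow unfolding partial_flow_def by blast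

lemma flow_in: "(t, x) \<in> \<Gamma> \<Longrightarrow> \<phi> t x \<in> X"
  using pflow unfolding partial_flow_def by fast

lemma zero_dom: "x \<in> X \<Longrightarrow> (0, x) \<in> \<Gamma>"
  using pflow unfolding partial_flow_def dom_iff by blast

lemma flow_0 [simp]: "x \<in> X \<Longrightarrow> \<phi> 0 x = x"
  using pflow unfolding partial_flow_def by blast

lemma dom_open: "openin (top_of_set (UNIV \<times> X)) \<Gamma>"
  and flow_cont: "continuous_on \<Gamma> (\<lambda>(t, x). \<phi> t x)"
  using pflow unfolding partial_flow_def by blast+

lemma compact_K: "compact K" and K_subset: "K \<subseteq> X"
  using isol unfolding isolating_nbhd_def by blast+

text \<open>The points between 0 and \<open>t\<close> are written \<open>l * t\<close>, which treats
  both signs of \<open>t\<close> at once.\<close>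

lemma dom_connected:
  assumes "(t, x) \<in> \<Gamma>" "0 \<le> l" "l \<le> 1" shows "(l * t, x) \<in> \<Gamma>"
proof -
  have x: "x \<in> X" using assms dom_subset by blast
  then have "connected (dom_at \<Gamma> x)" using pflow by (auto simp: partial_flow_def)
  moreover have "0 \<in> dom_at \<Gamma> x" "t \<in> dom_at \<Gamma> x" using assms x zero_dom by (auto simp: dom_iff)
  moreover have "l * t \<in> {0..t} \<or> l * t \<in> {t..0}"
    using assms mult_left_le_one_le[of t l] mult_left_le_one_le[of "-t" l]
    by (cases "0 \<le> t") (auto simp: mult_nonneg_nonpos)
  ultimately have "l * t \<in> dom_at \<Gamma> x" by (meson atLeastAtMost_iff connectedD_interval)
  then show ?thesis by (simp add: dom_iff)
qed

lemma dom_flow_iff: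
  assumes "(t, x) \<in> \<Gamma>" shows "(s, \<phi> t x) \<in> \<Gamma> \<longleftrightarrow> (s + t, x) \<in> \<Gamma>"
proof -
  have "dom_at \<Gamma> (\<phi> t x) = (\<lambda>s. s - t) ` dom_at \<Gamma> x"
    using pflow assms unfolding partial_flow_def by fast
  then have "s \<in> dom_at \<Gamma> (\<phi> t x) \<longleftrightarrow> s \<in> (\<lambda>s. s - t) ` dom_at \<Gamma> x" by simp
  also have "\<dots> \<longleftrightarrow> s + t \<in> dom_at \<Gamma> x" by force
  finally show ?thesis by (simp add: dom_iff)
qed

lemma flow_limit:
  assumes "(f \<longlongrightarrow> x) F" "(u \<longlongrightarrow> t) F" "(t, x) \<in> \<Gamma>" "\<forall>\<^sub>F i in F. f i \<in> X"
  shows "\<forall>\<^sub>F i in F. (u i, f i) \<in> \<Gamma>" "((\<lambda>i. \<phi> (u i) (f i)) \<longlongrightarrow> \<phi> t x) F"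
proof -
  have lim: "((\<lambda>i. (u i, f i)) \<longlongrightarrow> (t, x)) F" using assms by (intro tendsto_Pair)
  obtain T where T: "open T" "\<Gamma> = (UNIV \<times> X) \<inter> T"
    using dom_open by (auto simp: openin_open)
  then have "\<forall>\<^sub>F i in F. (u i, f i) \<in> T" using lim assms(3) by (auto intro: topological_tendstoD)
  then show ev: "\<forall>\<^sub>F i in F. (u i, f i) \<in> \<Gamma>" using assms(4) by eventually_elim (use T in auto)
  show "((\<lambda>i. \<phi> (u i) (f i)) \<longlongrightarrow> \<phi> t x) F"
    using continuous_on_tendsto_compose[OF flow_cont lim assms(3) ev] by simp
qed

section \<open>From the postulated flow law to the full one\<close>

lemma flow_add_raw:
  assumes "(s, x) \<in> \<Gamma>" "(t, x) \<in> \<Gamma>" "(s + t, x) \<in> \<Gamma>"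
  shows "\<phi> s (\<phi> t x) = \<phi> (s + t) x"
proof -
  have "x \<in> X" using assms dom_subset by blast
  then show ?thesis using pflow assms unfolding partial_flow_def dom_iff by blast
qed

text \<open>Failures at times tending to 0 would have base points accumulating at some
  \<open>l\<close> in \<open>C\<close>, although \<open>(0, l)\<close> lies in the relatively open
  set \<Gamma>.\<close>

lemma uniform_domain:
  assumes "compact C" "C \<subseteq> X"
  shows "\<exists>e>0. \<forall>y\<in>C. \<forall>r. \<bar>r\<bar> < e \<longrightarrow> (r, y) \<in> \<Gamma>"
proof (rule ccontr)
  assume "\<not> ?thesis"
  then have "\<forall>n. \<exists>y r. y \<in> C \<and> \<bar>r\<bar> < inverse (real (Suc n)) \<and> (r, y) \<notin> \<Gamma>"
    by (metis inverse_positive_iff_positive of_nat_0_less_iff zero_less_Suc)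
  then obtain y r where yr: "\<And>n. y n \<in> C" "\<And>n. \<bar>r n\<bar> < inverse (real (Suc n))" "\<And>n. (r n, y n) \<notin> \<Gamma>"
    by metis
  obtain l \<rho> where l: "l \<in> C" "strict_mono \<rho>" "(y \<circ> \<rho>) \<longlonglongrightarrow> l"
    using assms(1) yr(1) unfolding compact_eq_seq_compact_metric seq_compact_def by metis
  have "r \<longlonglongrightarrow> 0"
    by (rule Lim_null_comparison[OF _ LIMSEQ_inverse_real_of_nat])
      (simp add: less_imp_le[OF yr(2)] del: of_nat_Suc)
  then have r: "(r \<circ> \<rho>) \<longlonglongrightarrow> 0" using l(2) by (rule LIMSEQ_subseq_LIMSEQ)
  have "\<forall>\<^sub>F n in sequentially. ((r \<circ> \<rho>) n, (y \<circ> \<rho>) n) \<in> \<Gamma>"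
    by (intro flow_limit(1)[OF l(3) r] zero_dom always_eventually)
      (use l assms yr(1) in auto)
  then show False using yr(3) by simp
qed

text \<open>The flow law of a partial flow is only postulated for \<open>s \<in> \<Gamma>\<^sub>x\<close>. When \<open>s\<close> lies outside
  \<open>\<Gamma>\<^sub>x\<close>, one has to return from \<open>\<phi>\<^sub>t(x)\<close> to \<open>x\<close> in small steps.\<close>
lemma flow_inverse:
  assumes "(t, x) \<in> \<Gamma>" shows "\<phi> (- t) (\<phi> t x) = x"
proof -
  have x: "x \<in> X" using assms dom_subset by blast
  define C where "C = (\<lambda>l. \<phi> (l * t) x) ` {0..1}"
  have "continuous_on {0..1} ((\<lambda>(t, x). \<phi> t x) \<circ> (\<lambda>l. (l * t, x)))"
    by (intro continuous_on_compose continuous_intros continuous_on_subset[OF flow_cont])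
      (auto intro: dom_connected assms)
  then have cC: "compact C" unfolding C_def
    by (intro compact_continuous_image) (auto simp: o_def)
  have CX: "C \<subseteq> X" by (auto simp: C_def intro!: flow_in dom_connected assms)
  obtain e where e: "e > 0" "\<And>y r. y \<in> C \<Longrightarrow> \<bar>r\<bar> < e \<Longrightarrow> (r, y) \<in> \<Gamma>"
    using uniform_domain[OF cC CX] by blast
  obtain m where m: "\<bar>t\<bar> / e < real m" using reals_Archimedean2 by blast
  have "0 \<le> \<bar>t\<bar> / e" using e(1) by simp
  with m have "0 < real m" by linarith
  with m have m: "\<bar>t\<bar> / e < real m" "m > 0" by simp_all
  \<comment> \<open>A step below the uniform radius, so that \<open>d\<close> and \<open>- d\<close>
    are both admissible at every point of the arc \<open>C\<close>.\<close>
  define d where "d = t / m"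
  have d: "\<bar>d\<bar> < e" using m e(1) by (simp add: d_def abs_divide field_simps)
  have dom: "(real k * d, x) \<in> \<Gamma>" if "k \<le> m" for k
    using dom_connected[OF assms, of "real k / m"] that m by (simp add: d_def)
  have "\<phi> (- (real k * d)) (\<phi> (real k * d) x) = x" if "k \<le> m" for k
    using that
  proof (induction k)
    case 0
    then show ?case using x by simp
  next
    case (Suc k)
    define z where "z = \<phi> (real k * d) x"
    define z' where "z' = \<phi> (real (Suc k) * d) x"
    have domk: "(real k * d, x) \<in> \<Gamma>" "(real (Suc k) * d, x) \<in> \<Gamma>" "(d, x) \<in> \<Gamma>"
      using dom[of k] dom[of "Suc k"] dom[of 1] Suc.prems by auto
    have "z = \<phi> (real k / m * t) x" by (simp add: z_def d_def)
    then have "z \<in> C" unfolding C_def using Suc.prems m by (intro image_eqI[where x = "real k / m"]) auto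
    then have z: "(d, z) \<in> \<Gamma>" "(- d, z) \<in> \<Gamma>" "z \<in> X" using e(2) d CX by auto
    have z': "\<phi> d z = z'" using flow_add_raw[of d x "real k * d"] domk
      by (simp add: z_def z'_def algebra_simps)
    \<comment> \<open>The postulated law applies at \<open>z'\<close> because \<open>d\<close>,
      \<open>real k * d\<close> and 0 all lie in the domain of \<open>x\<close>.\<close>
    have "\<phi> (- (real (Suc k) * d)) z' = \<phi> (- (real k * d)) (\<phi> (- d) z')"
      using flow_add_raw[of "- (real k * d)" z' "- d"] domk x zero_dom
      by (simp add: z'_def dom_flow_iff algebra_simps)
    \<comment> \<open>Undoing a single step uses that \<open>- d\<close> is admissible at
      \<open>z\<close>, hence the small step size.\<close>
    also have "\<phi> (- d) z' = z"
      using flow_add_raw[of "- d" z d] z zero_dom by (simp flip: z')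
    finally show ?case using Suc by (simp add: z_def z'_def)
  qed
  from this[of m] show ?thesis using m by (simp add: d_def)
qed

text \<open>Unless the signs are opposite, \<open>s\<close> lies between 0 and \<open>s + t\<close>
  and the postulated law applies. Otherwise \<open>flow_inverse\<close> helps: a return that does
  not pass \<open>x\<close> inverts the motion by \<open>- s\<close>, and one that passes
  \<open>x\<close> is split there.\<close>

lemma flow_add:
  assumes "(t, x) \<in> \<Gamma>" "(s + t, x) \<in> \<Gamma>"
  shows "\<phi> s (\<phi> t x) = \<phi> (s + t) x"
proof -
  have x: "x \<in> X" "(0, x) \<in> \<Gamma>" using assms dom_subset zero_dom by blast+
  have between: "(r, x) \<in> \<Gamma>" if "(u, x) \<in> \<Gamma>" "0 \<le> r \<and> r \<le> u \<or> u \<le> r \<and> r \<le> 0" for r u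
    using dom_connected[OF that(1), of "r / u"] that x
    by (cases "u = 0") (auto simp: divide_simps)
  consider "0 \<le> s * t" | "s * t < 0" "\<bar>s\<bar> \<le> \<bar>t\<bar>" | "s * t < 0" "\<bar>t\<bar> < \<bar>s\<bar>" by linarith
  then show ?thesis
  proof cases
    case 1
    then have "(s, x) \<in> \<Gamma>" using between[OF assms(2), of s] by (auto simp: zero_le_mult_iff)
    then show ?thesis using assms by (rule flow_add_raw)
  next
    case 2
    then have "(- s, x) \<in> \<Gamma>" using between[OF assms(1), of "- s"] by (auto simp: mult_less_0_iff)
    then have "\<phi> t x = \<phi> (- s) (\<phi> (s + t) x)" using flow_add_raw[of "- s" x "s + t"] assms by simp
    then show ?thesis using flow_inverse[of "- s" "\<phi> (s + t) x"] assms by (simp add: dom_flow_iff)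
  next
    case 3
    \<comment> \<open>The law will be used at \<open>\<phi> t x\<close> with times
      \<open>s + t\<close> and \<open>- t\<close>, which requires \<open>s + t + t\<close> in the
      domain of \<open>x\<close>.\<close>
    define r where "r = s + t + t"
    have "(0 \<le> r \<and> r \<le> s + t \<or> s + t \<le> r \<and> r \<le> 0) \<or> (0 \<le> r \<and> r \<le> t \<or> t \<le> r \<and> r \<le> 0)"
      using 3 by (auto simp: mult_less_0_iff r_def)
    then have "(s + t + t, x) \<in> \<Gamma>" using between assms unfolding r_def by blast
    then have "\<phi> s (\<phi> t x) = \<phi> (s + t) (\<phi> (- t) (\<phi> t x))"
      using flow_add_raw[of "s + t" "\<phi> t x" "- t"] assms x by (simp add: dom_flow_iff)
    then show ?thesis using flow_inverse[OF assms(1)] by simp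
  qed
qed

section \<open>Orbits that stay in the compact set\<close>

lemma stays_in_K:
  assumes x: "x \<in> K"
    and stay: "\<And>l. 0 \<le> l \<Longrightarrow> l < 1 \<Longrightarrow> (l * s, x) \<in> \<Gamma> \<Longrightarrow> \<phi> (l * s) x \<in> K"
  shows "(s, x) \<in> \<Gamma> \<and> \<phi> s x \<in> K"
proof -
  \<comment> \<open>One step length works at all points of \<open>K\<close>, so the orbit cannot run
    out of its domain while it is in \<open>K\<close>.\<close>
  obtain e where e: "e > 0" "\<And>y r. y \<in> K \<Longrightarrow> \<bar>r\<bar> < e \<Longrightarrow> (r, y) \<in> \<Gamma>"
    using uniform_domain[OF compact_K K_subset] by blast
  obtain m where m: "\<bar>s\<bar> / e < real m" using reals_Archimedean2 by blast
  have "0 \<le> \<bar>s\<bar> / e" using e(1) by simp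
  with m have "0 < real m" by linarith
  with m have m: "\<bar>s\<bar> / e < real m" "m > 0" by simp_all
  have d: "\<bar>s / m\<bar> < e" using m e(1) by (simp add: abs_divide field_simps)
  have "(real k / m * s, x) \<in> \<Gamma>" if "k \<le> m" for k
    using that
  proof (induction k)
    case 0
    then show ?case using x K_subset zero_dom by auto
  next
    case (Suc k)
    then have dom: "(real k / m * s, x) \<in> \<Gamma>" by simp
    then have "\<phi> (real k / m * s) x \<in> K" using Suc.prems by (intro stay) auto
    then have "(s / m, \<phi> (real k / m * s) x) \<in> \<Gamma>" using e(2) d by blast
    then show ?case using dom by (simp add: dom_flow_iff add_divide_distrib distrib_right)
  qed
  from this[of m] have dom: "(s, x) \<in> \<Gamma>" using m by simp
  \<comment> \<open>The assumption excludes \<open>l = 1\<close>; the endpoint is approached from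
    below and lies in \<open>K\<close> by closedness.\<close>
  define l where "l = (\<lambda>n. real n / real (Suc n))"
  have l: "0 \<le> l n" "l n < 1" for n by (simp_all add: l_def)
  have "l \<longlonglongrightarrow> 1" unfolding l_def by (rule LIMSEQ_n_over_Suc_n)
  then have "(\<lambda>n. l n * s) \<longlonglongrightarrow> 1 * s" by (intro tendsto_intros)
  then have "(\<lambda>n. \<phi> (l n * s) x) \<longlonglongrightarrow> \<phi> (1 * s) x"
    using x K_subset dom by (intro flow_limit(2)[where f = "\<lambda>_. x"]) auto
  moreover have "\<phi> (l n * s) x \<in> K" for n
    using l[of n] dom by (intro stay dom_connected) auto
  ultimately have "\<phi> (1 * s) x \<in> K"
    by (rule closed_sequentially[OF compact_imp_closed[OF compact_K], rotated])
  then show ?thesis using dom by simp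
qed

text \<open>Convergence alone does not control the domain of the limit point. But wherever
  \<open>\<phi> (l * s) x\<close> is defined it is a limit of points of \<open>K\<close>, and
  \<open>stays_in_K\<close> then extends the domain up to \<open>s\<close>.\<close>

lemma limit_stays_in_K:
  assumes f: "f \<longlonglongrightarrow> x" and u: "u \<longlonglongrightarrow> s"
    and stay: "\<And>n l. 0 \<le> l \<Longrightarrow> l \<le> 1 \<Longrightarrow> (l * u n, f n) \<in> \<Gamma> \<and> \<phi> (l * u n) (f n) \<in> K"
  shows "(s, x) \<in> \<Gamma> \<and> \<phi> s x \<in> K"
proof -
  have clK: "closed K" using compact_K by (rule compact_imp_closed)
  have fX: "f n \<in> X" for n using stay[of 0 n] dom_subset by auto
  then have fK: "f n \<in> K" for n using stay[of 0 n] by simp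
  have x: "x \<in> K" using closed_sequentially[OF clK fK f] .
  have "\<phi> (l * s) x \<in> K" if "0 \<le> l" "l < 1" "(l * s, x) \<in> \<Gamma>" for l
  proof -
    have "(\<lambda>n. \<phi> (l * u n) (f n)) \<longlonglongrightarrow> \<phi> (l * s) x"
      using fX that f by (intro flow_limit(2) tendsto_intros u) auto
    then show ?thesis using closed_sequentially[OF clK] stay that by (meson less_imp_le)
  qed
  then show ?thesis using stays_in_K x by blast
qed

section \<open>Orbit segments and their compactness\<close>

text \<open>A state \<open>(x, a, b)\<close> records an orbit segment in \<open>K\<close> that is entered at time \<open>a\<close> and left
  at time \<open>b\<close>; the point \<open>x\<close> is its position at the time of \<open>[a, b]\<close> closest to the present
  time \<open>0\<close>. For \<open>a = b = \<plusminus>\<infinity>\<close> there is no segment and \<open>x\<close> is meaningless.\<close>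
definition state :: "'a \<Rightarrow> ereal \<Rightarrow> ereal \<Rightarrow> bool" where
  "state x a b \<longleftrightarrow> a \<le> b \<and>
     (\<forall>s. a \<le> ereal (clamp_time a b 0 + s) \<longrightarrow> ereal (clamp_time a b 0 + s) \<le> b \<longrightarrow>
          (s, x) \<in> \<Gamma> \<and> \<phi> s x \<in> K)"

text \<open>Translation by \<open>t\<close> makes the old time \<open>t\<close> the present, so the
  marked point slides from the clamped time 0 to the clamped time \<open>t\<close>.\<close>

definition shift_pos :: "real \<Rightarrow> 'a \<Rightarrow> ereal \<Rightarrow> ereal \<Rightarrow> 'a" where
  "shift_pos t x a b = \<phi> (clamp_time a b t - clamp_time a b 0) x"

lemma state_le: "state x a b \<Longrightarrow> a \<le> b"
  by (simp add: state_def)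

lemma stateD:
  assumes "state x a b" "a \<noteq> \<infinity>" "b \<noteq> -\<infinity>"
  shows "(clamp_time a b t - clamp_time a b 0, x) \<in> \<Gamma>"
    "\<phi> (clamp_time a b t - clamp_time a b 0) x \<in> K"
proof -
  have "a \<le> ereal (clamp_time a b t)" "ereal (clamp_time a b t) \<le> b"
    using clamp_time_bounds assms state_le by blast+
  then show "(clamp_time a b t - clamp_time a b 0, x) \<in> \<Gamma>"
    "\<phi> (clamp_time a b t - clamp_time a b 0) x \<in> K"
    using assms(1)[unfolded state_def, THEN conjunct2, rule_format, of "clamp_time a b t - clamp_time a b 0"]
    by simp_all
qed

lemma state_in_K:
  assumes "state x a b" "a \<noteq> \<infinity>" "b \<noteq> -\<infinity>" shows "x \<in> K"
proof -
  have "(0, x) \<in> \<Gamma>" "\<phi> 0 x \<in> K" using stateD[OF assms, of 0] by simp_all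
  then show ?thesis using dom_subset by force
qed

lemma state_infinite: "state x \<infinity> \<infinity>" "state x (-\<infinity>) (-\<infinity>)"
  by (simp_all add: state_def)

lemma state_cases:
  assumes "state x a b"
  obtains "a = \<infinity>" "b = \<infinity>" | "a = -\<infinity>" "b = -\<infinity>" | "a \<noteq> \<infinity>" "b \<noteq> -\<infinity>"
  using state_le[OF assms] by (cases a; cases b) auto

lemma state_shift:
  assumes "state x a b"
  shows "state (shift_pos t x a b) (a - ereal t) (b - ereal t)"
  using assms
proof (cases rule: state_cases)
  case 3
  define v where "v = clamp_time a b t - clamp_time a b 0"
  have v: "(v, x) \<in> \<Gamma>" using stateD[OF assms 3] by (simp add: v_def)
  have "(s, \<phi> v x) \<in> \<Gamma> \<and> \<phi> s (\<phi> v x) \<in> K"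
    if "a - ereal t \<le> ereal (clamp_time a b t - t + s)" "ereal (clamp_time a b t - t + s) \<le> b - ereal t" for s
  proof -
    have "a \<le> ereal (clamp_time a b 0 + (s + v))" "ereal (clamp_time a b 0 + (s + v)) \<le> b"
      using that 3 by (cases a; cases b; simp add: v_def)+
    then have "(s + v, x) \<in> \<Gamma> \<and> \<phi> (s + v) x \<in> K" using assms unfolding state_def by blast
    then show ?thesis using v by (simp add: dom_flow_iff flow_add)
  qed
  moreover have "a - ereal t \<le> b - ereal t" using state_le[OF assms] by (intro ereal_minus_mono) auto
  ultimately show ?thesis
    unfolding state_def shift_pos_def clamp_time_shift[OF 3] v_def by simp
qed (simp_all add: state_infinite)

lemma shift_pos_add:
  assumes "state x a b" "a \<noteq> \<infinity>" "b \<noteq> -\<infinity>"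
  shows "shift_pos s (shift_pos t x a b) (a - ereal t) (b - ereal t) = shift_pos (s + t) x a b"
proof -
  have "clamp_time a b (s + t) - clamp_time a b t + (clamp_time a b t - clamp_time a b 0)
      = clamp_time a b (s + t) - clamp_time a b 0" by simp
  then have "\<phi> (clamp_time a b (s + t) - clamp_time a b t) (\<phi> (clamp_time a b t - clamp_time a b 0) x)
      = \<phi> (clamp_time a b (s + t) - clamp_time a b 0) x"
    using stateD(1)[OF assms] by (metis flow_add)
  then show ?thesis by (simp add: shift_pos_def clamp_time_shift[OF assms(2,3)])
qed

text \<open>Entry and exit times subconverge in [-\<infinity>, \<infinity>]. If the limit interval
  contains real times, the positions subconverge in \<open>K\<close> too and the limit is again a
  segment; otherwise it recedes to infinity and carries no position.\<close>

lemma states_compact: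
  fixes x :: "nat \<Rightarrow> 'a" and a b :: "nat \<Rightarrow> ereal"
  assumes st: "\<And>n. state (x n) (a n) (b n)"
  obtains r x' a' b' where "strict_mono (r :: nat \<Rightarrow> nat)" "state x' a' b'"
    "(\<lambda>n. a (r n)) \<longlonglongrightarrow> a'" "(\<lambda>n. b (r n)) \<longlonglongrightarrow> b'"
    "a' \<noteq> \<infinity> \<Longrightarrow> b' \<noteq> -\<infinity> \<Longrightarrow> (\<lambda>n. x (r n)) \<longlonglongrightarrow> x'"
proof -
  have "seq_compact (UNIV :: ereal set)" using compact_UNIV by (rule compact_imp_seq_compact)
  then have sub: "\<exists>l r. strict_mono (r :: nat \<Rightarrow> nat) \<and> (f \<circ> r) \<longlonglongrightarrow> l" for f :: "nat \<Rightarrow> ereal"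
    by (metis UNIV_I seq_compact_def)
  obtain a' r1 where r1: "strict_mono (r1 :: nat \<Rightarrow> nat)" "(a \<circ> r1) \<longlonglongrightarrow> a'" using sub by blast
  obtain b' r2 where r2: "strict_mono (r2 :: nat \<Rightarrow> nat)" "((b \<circ> r1) \<circ> r2) \<longlonglongrightarrow> b'" using sub by blast
  define r where "r = r1 \<circ> r2"
  have r: "strict_mono r" using r1 r2 by (simp add: r_def strict_mono_o)
  have a: "(\<lambda>n. a (r n)) \<longlonglongrightarrow> a'"
    using LIMSEQ_subseq_LIMSEQ[OF r1(2) r2(1)] by (simp add: r_def o_def)
  have b: "(\<lambda>n. b (r n)) \<longlonglongrightarrow> b'" using r2(2) by (simp add: r_def o_def)
  have ab: "a' \<le> b'" using a b st by (intro LIMSEQ_le[OF a b]) (auto intro: state_le)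
  show ?thesis
  proof (cases "a' = \<infinity> \<or> b' = -\<infinity>")
    case True
    then have "a' = \<infinity> \<and> b' = \<infinity> \<or> a' = -\<infinity> \<and> b' = -\<infinity>" using ab by auto
    then have "state undefined a' b'" by (auto simp: state_infinite)
    then show ?thesis using that r a b True by blast
  next
    case False
    have "\<forall>\<^sub>F n in sequentially. a (r n) < \<infinity> \<and> b (r n) > -\<infinity>"
      using order_tendstoD(2)[OF a, of \<infinity>] order_tendstoD(1)[OF b, of "-\<infinity>"] False
      by (simp add: eventually_conj_iff)
    \<comment> \<open>From index \<open>M\<close> on the intervals contain real times, which puts
      the marked points in \<open>K\<close>.\<close>
    then obtain M where M: "\<And>n. n \<ge> M \<Longrightarrow> a (r n) \<noteq> \<infinity> \<and> b (r n) \<noteq> -\<infinity>"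
      unfolding eventually_sequentially by fastforce
    have "x (r (n + M)) \<in> K" for n using state_in_K[OF st] M[of "n + M"] by simp
    then obtain x' r3 where r3: "strict_mono (r3 :: nat \<Rightarrow> nat)" "((\<lambda>n. x (r (n + M))) \<circ> r3) \<longlonglongrightarrow> x'"
      using compact_K unfolding compact_eq_seq_compact_metric seq_compact_def by metis
    define \<rho> where "\<rho> = (\<lambda>n. r (r3 n + M))"
    have \<rho>: "strict_mono \<rho>" using r r3(1) by (simp add: \<rho>_def strict_mono_def)
    have sm: "strict_mono (\<lambda>n. r3 n + M)" using r3(1) by (simp add: strict_mono_def)
    have x: "(\<lambda>n. x (\<rho> n)) \<longlonglongrightarrow> x'" using r3(2) by (simp add: \<rho>_def o_def)
    have a: "(\<lambda>n. a (\<rho> n)) \<longlonglongrightarrow> a'" and b: "(\<lambda>n. b (\<rho> n)) \<longlonglongrightarrow> b'"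
      using LIMSEQ_subseq_LIMSEQ[OF a sm] LIMSEQ_subseq_LIMSEQ[OF b sm] by (simp_all add: \<rho>_def o_def)
    have fin: "a (\<rho> n) \<noteq> \<infinity>" "b (\<rho> n) \<noteq> -\<infinity>" for n using M by (simp_all add: \<rho>_def)
    have "(s, x') \<in> \<Gamma> \<and> \<phi> s x' \<in> K"
      if s: "a' \<le> ereal (clamp_time a' b' 0 + s)" "ereal (clamp_time a' b' 0 + s) \<le> b'" for s
    proof -
      define c where "c = (\<lambda>n t. clamp_time (a (\<rho> n)) (b (\<rho> n)) t)"
      \<comment> \<open>Clamping a time of the limit segment into the n-th interval yields
        admissible times that converge to it.\<close>
      define u where "u = (\<lambda>n. c n (clamp_time a' b' 0 + s) - c n 0)"
      have "u \<longlonglongrightarrow> clamp_time a' b' (clamp_time a' b' 0 + s) - clamp_time a' b' 0"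
        unfolding u_def c_def using False
        by (intro tendsto_diff tendsto_clamp_time a b tendsto_const) auto
      then have u: "u \<longlonglongrightarrow> s" using clamp_time_id[OF s] by simp
      show ?thesis
      proof (rule limit_stays_in_K[OF x u])
        fix n and l :: real assume l: "0 \<le> l" "l \<le> 1"
        have bd: "a (\<rho> n) \<le> ereal (c n t)" "ereal (c n t) \<le> b (\<rho> n)" for t
          unfolding c_def using clamp_time_bounds[OF fin state_le[OF st]] by auto
        let ?v = "c n (clamp_time a' b' 0 + s)"
        have eq: "c n 0 + l * u n = (1 - l) * c n 0 + l * ?v" by (simp add: u_def algebra_simps)
        have "min (c n 0) ?v \<le> c n 0 + l * u n" "c n 0 + l * u n \<le> max (c n 0) ?v"
          unfolding eq using l convex_bound_le[of "c n 0" "max (c n 0) ?v" ?v "1 - l" l]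
            convex_bound_le[of "- c n 0" "- min (c n 0) ?v" "- ?v" "1 - l" l] by auto
        then have "ereal (min (c n 0) ?v) \<le> ereal (c n 0 + l * u n)"
          "ereal (c n 0 + l * u n) \<le> ereal (max (c n 0) ?v)" by (simp_all only: ereal_less_eq)
        moreover have "a (\<rho> n) \<le> ereal (min (c n 0) ?v)" "ereal (max (c n 0) ?v) \<le> b (\<rho> n)"
          using bd by (auto simp: min_def max_def)
        ultimately have "a (\<rho> n) \<le> ereal (c n 0 + l * u n)" "ereal (c n 0 + l * u n) \<le> b (\<rho> n)"
          by (blast intro: order_trans)+
        then show "(l * u n, x (\<rho> n)) \<in> \<Gamma> \<and> \<phi> (l * u n) (x (\<rho> n)) \<in> K"
          using st[of "\<rho> n"] unfolding state_def c_def by blast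
      qed
    qed
    then have "state x' a' b'" using ab by (simp add: state_def)
    then show ?thesis using that \<rho> a b x by blast
  qed
qed

end

section \<open>Regularised exit times\<close>

locale separated_system = isolated_system X \<Gamma> \<phi> L K
  for X :: "'a::metric_space set" and \<Gamma> :: "(real \<times> 'a) set"
    and \<phi> :: "real \<Rightarrow> 'a \<Rightarrow> 'a" and L K :: "'a set" +
  fixes N :: "'a set" and G :: "'a \<Rightarrow> ereal" and q :: "nat \<Rightarrow> 'a"
  assumes isolN: "isolating_nbhd X \<Gamma> \<phi> L N"
    and N_subset: "N \<subseteq> K"
    and G_cont: "continuous_on X G"
    and G_nonneg: "y \<in> X \<Longrightarrow> 0 \<le> G y"
    and G_N: "y \<in> N \<Longrightarrow> G y = \<infinity>"
    and G_outside: "y \<in> X \<Longrightarrow> y \<notin> K \<Longrightarrow> G y = 0"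
    and q_separates: "x \<in> K \<Longrightarrow> y \<in> K \<Longrightarrow> (\<And>k. dist x (q k) = dist y (q k)) \<Longrightarrow> x = y"
begin

text \<open>A continuous substitute for the time of exit from \<open>N\<close>, which is itself discontinuous
  where orbits touch the boundary of \<open>N\<close> from inside. The penalty \<open>G\<close> is infinite on \<open>N\<close> and
  vanishes off \<open>K\<close>, so the value lies between the exit times from \<open>N\<close> and from \<open>K\<close>. The sign
  \<open>\<sigma> = \<plusminus>1\<close> selects the direction of time.\<close>
definition exit_time :: "real \<Rightarrow> 'a \<Rightarrow> ereal" where
  "exit_time \<sigma> x = (INF s\<in>{s. 0 \<le> s \<and> (\<sigma> * s, x) \<in> \<Gamma>}. ereal s + G (\<phi> (\<sigma> * s) x))"

lemma exit_time_le:
  "0 \<le> s \<Longrightarrow> (\<sigma> * s, x) \<in> \<Gamma> \<Longrightarrow> exit_time \<sigma> x \<le> ereal s + G (\<phi> (\<sigma> * s) x)"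
  unfolding exit_time_def by (rule INF_lower) simp

lemma exit_time_nonneg: "0 \<le> exit_time \<sigma> x"
  unfolding exit_time_def by (rule INF_greatest) (auto intro!: add_nonneg_nonneg G_nonneg flow_in)

lemma exit_time_stays:
  assumes x: "x \<in> K" and s: "0 \<le> s" "ereal s \<le> exit_time \<sigma> x"
  shows "(\<sigma> * s, x) \<in> \<Gamma> \<and> \<phi> (\<sigma> * s) x \<in> K"
proof (rule stays_in_K[OF x])
  fix l assume l: "0 \<le> l" "l < 1" and dom: "(l * (\<sigma> * s), x) \<in> \<Gamma>"
  show "\<phi> (l * (\<sigma> * s)) x \<in> K"
  proof (cases "s = 0")
    case True
    then show ?thesis using x K_subset by auto
  next
    case False
    then have ls: "l * s < s" using s l by simp
    show ?thesis
    proof (rule ccontr)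
      assume "\<phi> (l * (\<sigma> * s)) x \<notin> K"
      then have "G (\<phi> (l * (\<sigma> * s)) x) = 0" using G_outside flow_in dom by blast
      then have "exit_time \<sigma> x \<le> ereal (l * s)"
        using exit_time_le[of "l * s" \<sigma> x] l s dom by (simp add: ac_simps)
      then have "ereal s \<le> ereal (l * s)" using s(2) by (rule order_trans[rotated])
      then show False using ls by simp
    qed
  qed
qed

lemma exit_time_shift:
  assumes \<tau>: "0 \<le> \<tau>"
    and stay: "\<And>s. 0 \<le> s \<Longrightarrow> s \<le> \<tau> \<Longrightarrow> (\<sigma> * s, x) \<in> \<Gamma> \<and> \<phi> (\<sigma> * s) x \<in> N"
  shows "exit_time \<sigma> x = ereal \<tau> + exit_time \<sigma> (\<phi> (\<sigma> * \<tau>) x)"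
proof (rule antisym)
  let ?z = "\<phi> (\<sigma> * \<tau>) x"
  have z: "(\<sigma> * \<tau>, x) \<in> \<Gamma>" using stay \<tau> by simp
  have "exit_time \<sigma> x - ereal \<tau> \<le> exit_time \<sigma> ?z"
    unfolding exit_time_def[of \<sigma> ?z]
  proof (rule INF_greatest, safe)
    fix s assume s: "0 \<le> s" "(\<sigma> * s, ?z) \<in> \<Gamma>"
    have eq: "\<sigma> * s + \<sigma> * \<tau> = \<sigma> * (s + \<tau>)" by (simp add: algebra_simps)
    have dom: "(\<sigma> * (s + \<tau>), x) \<in> \<Gamma>" using s(2) dom_flow_iff[OF z] eq by simp
    then have "\<phi> (\<sigma> * s) ?z = \<phi> (\<sigma> * (s + \<tau>)) x" using flow_add[OF z, of "\<sigma> * s"] eq by simp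
    then have "exit_time \<sigma> x \<le> ereal (s + \<tau>) + G (\<phi> (\<sigma> * s) ?z)"
      using exit_time_le[OF _ dom] s \<tau> by simp
    then show "exit_time \<sigma> x - ereal \<tau> \<le> ereal s + G (\<phi> (\<sigma> * s) ?z)"
      by (cases "exit_time \<sigma> x"; cases "G (\<phi> (\<sigma> * s) ?z)") auto
  qed
  then show "exit_time \<sigma> x \<le> ereal \<tau> + exit_time \<sigma> ?z"
    by (cases "exit_time \<sigma> x"; cases "exit_time \<sigma> ?z") auto
  show "ereal \<tau> + exit_time \<sigma> ?z \<le> exit_time \<sigma> x"
    unfolding exit_time_def[of \<sigma> x]
  proof (rule INF_greatest, safe)
    fix s assume s: "0 \<le> s" "(\<sigma> * s, x) \<in> \<Gamma>"
    show "ereal \<tau> + exit_time \<sigma> ?z \<le> ereal s + G (\<phi> (\<sigma> * s) x)"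
    proof (cases "s \<le> \<tau>")
      case True
      then show ?thesis using stay[of s] s G_N by simp
    next
      case False
      have eq: "\<sigma> * (s - \<tau>) + \<sigma> * \<tau> = \<sigma> * s" by (simp add: algebra_simps)
      have "(\<sigma> * (s - \<tau>), ?z) \<in> \<Gamma>" using s(2) dom_flow_iff[OF z] eq by simp
      moreover have "\<phi> (\<sigma> * (s - \<tau>)) ?z = \<phi> (\<sigma> * s) x"
        using flow_add[OF z, of "\<sigma> * (s - \<tau>)"] eq s by simp
      ultimately have "exit_time \<sigma> ?z \<le> ereal (s - \<tau>) + G (\<phi> (\<sigma> * s) x)"
        using exit_time_le[of "s - \<tau>" \<sigma> ?z] False by simp
      then show ?thesis
        by (cases "exit_time \<sigma> ?z"; cases "G (\<phi> (\<sigma> * s) x)") auto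
    qed
  qed
qed

lemma continuous_on_exit_time: "continuous_on K (exit_time \<sigma>)"
proof (rule continuous_on_sequentiallyI)
  fix f x assume f: "\<forall>n. f n \<in> K" "x \<in> K" "f \<longlonglongrightarrow> x"
  have fX: "f n \<in> X" for n using f K_subset by blast
  have lim: "(\<lambda>n. ereal (s n) + G (\<phi> (\<sigma> * s n) (g n))) \<longlonglongrightarrow> ereal s' + G (\<phi> (\<sigma> * s') x)"
    "\<forall>\<^sub>F n in sequentially. (\<sigma> * s n, g n) \<in> \<Gamma>"
    if "s \<longlonglongrightarrow> s'" "g \<longlonglongrightarrow> x" "(\<sigma> * s', x) \<in> \<Gamma>" "\<And>n. g n \<in> X" for s s' g
  proof -
    have t: "(\<lambda>n. \<sigma> * s n) \<longlonglongrightarrow> \<sigma> * s'" using that by (intro tendsto_intros)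
    note fl = flow_limit[OF that(2) t that(3) always_eventually[OF allI[OF that(4)]]]
    show "\<forall>\<^sub>F n in sequentially. (\<sigma> * s n, g n) \<in> \<Gamma>" by (rule fl(1))
    have ev: "\<forall>\<^sub>F n in sequentially. \<phi> (\<sigma> * s n) (g n) \<in> X"
      using fl(1) by eventually_elim (rule flow_in)
    have "(\<lambda>n. G (\<phi> (\<sigma> * s n) (g n))) \<longlonglongrightarrow> G (\<phi> (\<sigma> * s') x)"
      using continuous_on_tendsto_compose[OF G_cont fl(2) flow_in[OF that(3)] ev] .
    moreover have "G (\<phi> (\<sigma> * s') x) \<noteq> -\<infinity>" using G_nonneg[OF flow_in[OF that(3)]] by auto
    ultimately show "(\<lambda>n. ereal (s n) + G (\<phi> (\<sigma> * s n) (g n))) \<longlonglongrightarrow> ereal s' + G (\<phi> (\<sigma> * s') x)"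
      using that(1) by (intro tendsto_add_ereal_general) auto
  qed
  show "(\<lambda>n. exit_time \<sigma> (f n)) \<longlonglongrightarrow> exit_time \<sigma> x"
  proof (rule order_tendstoI)
    fix u assume "exit_time \<sigma> x < u"
    then obtain s where s: "0 \<le> s" "(\<sigma> * s, x) \<in> \<Gamma>" "ereal s + G (\<phi> (\<sigma> * s) x) < u"
      unfolding exit_time_def INF_less_iff by auto
    have "\<forall>\<^sub>F n in sequentially. ereal s + G (\<phi> (\<sigma> * s) (f n)) < u"
      by (rule order_tendstoD(2)[OF lim(1)[OF tendsto_const f(3) s(2) fX] s(3)])
    moreover have "\<forall>\<^sub>F n in sequentially. (\<sigma> * s, f n) \<in> \<Gamma>"
      by (rule lim(2)[OF tendsto_const f(3) s(2) fX])
    ultimately show "\<forall>\<^sub>F n in sequentially. exit_time \<sigma> (f n) < u"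
      by eventually_elim (use exit_time_le s(1) in \<open>blast intro: le_less_trans\<close>)
  next
    fix u assume u: "u < exit_time \<sigma> x"
    show "\<forall>\<^sub>F n in sequentially. u < exit_time \<sigma> (f n)"
    proof (rule ccontr)
      assume "\<not> ?thesis"
      then obtain r where r: "strict_mono (r :: nat \<Rightarrow> nat)" "\<And>n. \<not> u < exit_time \<sigma> (f (r n))"
        using not_eventually_sequentiallyD by blast
      obtain v where v: "u < ereal v" "ereal v < exit_time \<sigma> x" using ereal_dense2[OF u] by blast
      have "\<exists>s. 0 \<le> s \<and> (\<sigma> * s, f (r n)) \<in> \<Gamma> \<and> ereal s + G (\<phi> (\<sigma> * s) (f (r n))) < ereal v" for n
      proof -
        have "exit_time \<sigma> (f (r n)) < ereal v" using r(2) v(1) by (meson le_less_trans not_less)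
        then show ?thesis unfolding exit_time_def INF_less_iff by auto
      qed
      then obtain s where s: "\<And>n. 0 \<le> s n" "\<And>n. (\<sigma> * s n, f (r n)) \<in> \<Gamma>"
        "\<And>n. ereal (s n) + G (\<phi> (\<sigma> * s n) (f (r n))) < ereal v" by metis
      have sv: "s n \<in> {0..v}" for n
      proof -
        have "ereal (s n) \<le> ereal (s n) + G (\<phi> (\<sigma> * s n) (f (r n)))"
          using G_nonneg[OF flow_in[OF s(2)]] by (rule add_increasing2) simp
        then have "ereal (s n) < ereal v" using s(3) by (rule le_less_trans)
        then show ?thesis using s(1) by simp
      qed
      obtain s' \<rho> where s': "s' \<in> {0..v}" "strict_mono \<rho>" "(s \<circ> \<rho>) \<longlonglongrightarrow> s'"
        using sv compact_Icc[of 0 v] unfolding compact_eq_seq_compact_metric seq_compact_def by metis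
      have "ereal s' \<le> exit_time \<sigma> x" using s'(1) v(2)
        by (meson atLeastAtMost_iff ereal_less_eq(3) less_imp_le order_trans)
      then have dom: "(\<sigma> * s', x) \<in> \<Gamma>" using exit_time_stays[OF f(2)] s'(1) by simp
      have "(f \<circ> (r \<circ> \<rho>)) \<longlonglongrightarrow> x" using f(3) strict_mono_o[OF r(1) s'(2)] by (rule LIMSEQ_subseq_LIMSEQ)
      then have "(\<lambda>n. f (r (\<rho> n))) \<longlonglongrightarrow> x" by (simp add: o_def)
      moreover have "(\<lambda>n. s (\<rho> n)) \<longlonglongrightarrow> s'" using s'(3) by (simp add: o_def)
      ultimately have "(\<lambda>n. ereal (s (\<rho> n)) + G (\<phi> (\<sigma> * s (\<rho> n)) (f (r (\<rho> n))))) \<longlonglongrightarrow> ereal s' + G (\<phi> (\<sigma> * s') x)"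
        using dom fX by (intro lim(1)) auto
      then have "ereal s' + G (\<phi> (\<sigma> * s') x) \<le> ereal v"
        by (rule LIMSEQ_le_const2) (use s(3) less_imp_le in blast)
      then have "exit_time \<sigma> x \<le> ereal v"
        using exit_time_le[OF _ dom] s'(1) by (auto intro: order_trans)
      then show False using v(2) by simp
    qed
  qed
qed

end

section \<open>The flow on orbit segments\<close>

definition weight :: "ereal \<Rightarrow> ereal \<Rightarrow> real" where
  "weight a b = 1 - \<bar>squash (max a (min b 0))\<bar>"

lemma weight_nonneg: "0 \<le> weight a b"
  using abs_squash_le by (simp add: weight_def)

lemma weight_eq_0_iff: "a \<le> b \<Longrightarrow> weight a b = 0 \<longleftrightarrow> a = \<infinity> \<or> b = -\<infinity>"
  using abs_squash_eq_1_iff[of "max a (min b 0)"]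
  by (cases a; cases b) (auto simp: weight_def max_def min_def split: if_splits)

lemma tendsto_weight:
  assumes "(f \<longlongrightarrow> a) F" "(g \<longlongrightarrow> b) F"
  shows "((\<lambda>i. weight (f i) (g i)) \<longlongrightarrow> weight a b) F"
  unfolding weight_def
  by (intro tendsto_diff tendsto_const tendsto_rabs tendsto_squash tendsto_max tendsto_min assms)

context separated_system
begin

definition enc :: "'a \<Rightarrow> ereal \<Rightarrow> ereal \<Rightarrow> nat \<Rightarrow> real" where
  "enc x a b k = (if k = 0 then squash a else if k = 1 then squash b
                  else weight a b * dist x (q (k - 2)))"

lemma enc_eqD:
  assumes "enc x a b = enc x' a' b'" "state x a b" "state x' a' b'"
  shows "a = a'" "b = b'" "a \<noteq> \<infinity> \<Longrightarrow> b \<noteq> -\<infinity> \<Longrightarrow> x = x'"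
proof -
  have eq: "enc x a b k = enc x' a' b' k" for k using assms(1) by simp
  show a: "a = a'" using eq[of 0] by (simp add: enc_def)
  show b: "b = b'" using eq[of 1] by (simp add: enc_def)
  assume fin: "a \<noteq> \<infinity>" "b \<noteq> -\<infinity>"
  then have "weight a b \<noteq> 0" using weight_eq_0_iff state_le assms(2) by blast
  then have "dist x (q k) = dist x' (q k)" for k
    using eq[of "k + 2"] a b by (simp add: enc_def)
  then show "x = x'" using q_separates state_in_K assms fin a b by metis
qed

lemma enc_infinite: "enc x \<infinity> \<infinity> = enc y \<infinity> \<infinity>" "enc x (-\<infinity>) (-\<infinity>) = enc y (-\<infinity>) (-\<infinity>)"
  by (auto simp: enc_def weight_def)

lemma tendsto_enc:
  assumes st: "\<And>i. state (x i) (a i) (b i)" and st': "state x' a' b'"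
    and a: "(a \<longlongrightarrow> a') F" and b: "(b \<longlongrightarrow> b') F"
    and x: "a' \<noteq> \<infinity> \<Longrightarrow> b' \<noteq> -\<infinity> \<Longrightarrow> (x \<longlongrightarrow> x') F"
  shows "((\<lambda>i. enc (x i) (a i) (b i)) \<longlongrightarrow> enc x' a' b') F"
proof (rule tendsto_fun_componentwise)
  fix k
  have w: "((\<lambda>i. weight (a i) (b i)) \<longlongrightarrow> weight a' b') F" using a b by (rule tendsto_weight)
  have "((\<lambda>i. weight (a i) (b i) * dist (x i) p) \<longlongrightarrow> weight a' b' * dist x' p) F" for p
  proof (cases "a' = \<infinity> \<or> b' = -\<infinity>")
    case False
    then show ?thesis using x w by (intro tendsto_mult tendsto_dist tendsto_const) auto
  next
    case True
    then have w0: "weight a' b' = 0" using weight_eq_0_iff state_le st' by blast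
    have "bounded K" using compact_K by (rule compact_imp_bounded)
    then obtain B where B: "\<And>y. y \<in> K \<Longrightarrow> dist p y \<le> B"
      unfolding bounded_any_center[where a = p] by blast
    have bd: "norm (weight (a i) (b i) * dist (x i) p) \<le> weight (a i) (b i) * B" for i
    proof (cases "weight (a i) (b i) = 0")
      case False
      then have "x i \<in> K" using state_in_K[OF st] weight_eq_0_iff[OF state_le[OF st]] by blast
      then have "dist (x i) p \<le> B" using B[of "x i"] by (simp add: dist_commute)
      then show ?thesis by (simp add: abs_mult weight_nonneg mult_left_mono)
    qed simp
    have "((\<lambda>i. weight (a i) (b i) * B) \<longlongrightarrow> 0) F"
      using tendsto_mult_right[OF w, of B] w0 by simp
    then have "((\<lambda>i. weight (a i) (b i) * dist (x i) p) \<longlongrightarrow> 0) F"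
      by (rule Lim_null_comparison[OF always_eventually[OF allI[OF bd]]])
    then show ?thesis using w0 by simp
  qed
  then show "((\<lambda>i. enc (x i) (a i) (b i) k) \<longlongrightarrow> enc x' a' b' k) F"
    using tendsto_squash[OF a] tendsto_squash[OF b] by (simp add: enc_def)
qed

definition universe :: "(nat \<Rightarrow> real) set" where
  "universe = {enc x a b | x a b. state x a b}"

lemma universe_iff: "y \<in> universe \<longleftrightarrow> (\<exists>x a b. state x a b \<and> y = enc x a b)"
  unfolding universe_def by blast

lemma enc_in_universe: "state x a b \<Longrightarrow> enc x a b \<in> universe"
  by (auto simp: universe_def)

lemma universeE:
  assumes "y \<in> universe" obtains x a b where "state x a b" "y = enc x a b"
  using assms by (auto simp: universe_def)

lemma compact_universe: "compact universe"
  unfolding compact_eq_seq_compact_metric seq_compact_def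
proof (intro allI impI)
  fix f :: "nat \<Rightarrow> nat \<Rightarrow> real" assume "\<forall>n. f n \<in> universe"
  then have "\<forall>n. \<exists>x a b. state x a b \<and> f n = enc x a b" unfolding universe_iff .
  then obtain x a b where xab: "\<And>n. state (x n) (a n) (b n)" "\<And>n. f n = enc (x n) (a n) (b n)"
    by metis
  from states_compact[where x = x, OF xab(1)] obtain r x' a' b' where
    r: "strict_mono (r :: nat \<Rightarrow> nat)" "state x' a' b'"
    "(\<lambda>n. a (r n)) \<longlonglongrightarrow> a'" "(\<lambda>n. b (r n)) \<longlonglongrightarrow> b'"
    "a' \<noteq> \<infinity> \<Longrightarrow> b' \<noteq> -\<infinity> \<Longrightarrow> (\<lambda>n. x (r n)) \<longlonglongrightarrow> x'" by metis
  have "(f \<circ> r) \<longlonglongrightarrow> enc x' a' b'"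
    using tendsto_enc[OF xab(1) r(2-5)] by (simp add: o_def xab(2))
  then show "\<exists>l\<in>universe. \<exists>r. strict_mono r \<and> (f \<circ> r) \<longlonglongrightarrow> l"
    using r(1,2) enc_in_universe by blast
qed

definition flow :: "real \<Rightarrow> (nat \<Rightarrow> real) \<Rightarrow> nat \<Rightarrow> real" where
  "flow t y = (case SOME (x, a, b). state x a b \<and> enc x a b = y of
     (x, a, b) \<Rightarrow> enc (shift_pos t x a b) (a - ereal t) (b - ereal t))"

lemma flow_enc:
  assumes st: "state x a b"
  shows "flow t (enc x a b) = enc (shift_pos t x a b) (a - ereal t) (b - ereal t)"
proof -
  define p where "p = (SOME (x', a', b'). state x' a' b' \<and> enc x' a' b' = enc x a b)"
  obtain x' a' b' where p: "p = (x', a', b')" by (metis prod_cases3)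
  have "case p of (x', a', b') \<Rightarrow> state x' a' b' \<and> enc x' a' b' = enc x a b"
    unfolding p_def by (rule someI[where x = "(x, a, b)"]) (simp add: st)
  then have eq: "enc x' a' b' = enc x a b" and st': "state x' a' b'" by (simp_all add: p)
  have ab: "a' = a" "b' = b" using enc_eqD[OF eq st' st] by auto
  have "enc (shift_pos t x' a b) (a - ereal t) (b - ereal t) = enc (shift_pos t x a b) (a - ereal t) (b - ereal t)"
    using st
  proof (cases rule: state_cases)
    case 3
    then show ?thesis using enc_eqD(3)[OF eq st' st] ab by simp
  qed (use enc_infinite in auto)
  then show ?thesis by (simp add: flow_def flip: p_def) (simp add: p ab)
qed

lemma tendsto_flow:
  assumes st: "\<And>i. state (x i) (a i) (b i)" and st': "state x' a' b'"
    and a: "(a \<longlongrightarrow> a') F" and b: "(b \<longlongrightarrow> b') F"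
    and x: "a' \<noteq> \<infinity> \<Longrightarrow> b' \<noteq> -\<infinity> \<Longrightarrow> (x \<longlongrightarrow> x') F"
    and t: "(t \<longlongrightarrow> t') F"
  shows "((\<lambda>i. flow (t i) (enc (x i) (a i) (b i))) \<longlongrightarrow> flow t' (enc x' a' b')) F"
  unfolding flow_enc[OF st] flow_enc[OF st']
proof (rule tendsto_enc)
  show "((\<lambda>i. a i - ereal (t i)) \<longlongrightarrow> a' - ereal t') F" "((\<lambda>i. b i - ereal (t i)) \<longlongrightarrow> b' - ereal t') F"
    using a b t by (intro tendsto_diff_ereal_general; auto)+
  assume "a' - ereal t' \<noteq> \<infinity>" "b' - ereal t' \<noteq> -\<infinity>"
  then have fin: "a' \<noteq> \<infinity>" "b' \<noteq> -\<infinity>" by auto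
  have c: "((\<lambda>i. clamp_time (a i) (b i) (t i) - clamp_time (a i) (b i) 0)
      \<longlongrightarrow> clamp_time a' b' t' - clamp_time a' b' 0) F"
    using fin by (intro tendsto_diff tendsto_clamp_time a b t tendsto_const)
  have "\<forall>\<^sub>F i in F. a i < \<infinity>" "\<forall>\<^sub>F i in F. -\<infinity> < b i"
    using order_tendstoD(2)[OF a, of \<infinity>] order_tendstoD(1)[OF b, of "-\<infinity>"] fin by auto
  then have "\<forall>\<^sub>F i in F. x i \<in> X"
    by eventually_elim (use state_in_K[OF st] K_subset in auto)
  then show "((\<lambda>i. shift_pos (t i) (x i) (a i) (b i)) \<longlongrightarrow> shift_pos t' x' a' b') F"
    unfolding shift_pos_def
    using x[OF fin] c stateD(1)[OF st' fin] by (intro flow_limit(2))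
qed (intro state_shift st st')+

lemma flow_in_universe: "y \<in> universe \<Longrightarrow> flow t y \<in> universe"
  by (auto elim!: universeE simp: flow_enc intro!: enc_in_universe state_shift)

lemma flow_zero: "y \<in> universe \<Longrightarrow> flow 0 y = y"
proof (elim universeE)
  fix x a b assume st: "state x a b" and y: "y = enc x a b"
  from st show ?thesis
  proof (cases rule: state_cases)
    case 3
    then have "x \<in> X" using state_in_K[OF st] K_subset by blast
    then show ?thesis using st by (simp add: y flow_enc shift_pos_def zero_ereal_def[symmetric])
  qed (use st enc_infinite in \<open>auto simp: y flow_enc\<close>)
qed

lemma flow_plus: "y \<in> universe \<Longrightarrow> flow s (flow t y) = flow (s + t) y"
proof (elim universeE)
  fix x a b assume st: "state x a b" and y: "y = enc x a b"
  have eq: "a - ereal t - ereal s = a - ereal (s + t)" "b - ereal t - ereal s = b - ereal (s + t)"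
    by (cases a; cases b; simp)+
  have "flow s (flow t y) = enc (shift_pos s (shift_pos t x a b) (a - ereal t) (b - ereal t))
      (a - ereal (s + t)) (b - ereal (s + t))"
    using st by (simp add: y flow_enc state_shift eq)
  also have "\<dots> = enc (shift_pos (s + t) x a b) (a - ereal (s + t)) (b - ereal (s + t))"
    using st
  proof (cases rule: state_cases)
    case 3
    then show ?thesis by (simp only: shift_pos_add[OF st 3])
  qed (use enc_infinite in auto)
  also have "\<dots> = flow (s + t) y" using st by (simp add: y flow_enc)
  finally show ?thesis .
qed

lemma continuous_on_flow: "continuous_on (UNIV \<times> universe) (\<lambda>(t, y). flow t y)"
proof (rule continuous_on_sequentiallyI)
  fix u and p :: "real \<times> (nat \<Rightarrow> real)"
  assume u: "\<forall>n. u n \<in> UNIV \<times> universe" "p \<in> UNIV \<times> universe" "u \<longlonglongrightarrow> p"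
  define t where "t = fst \<circ> u"
  define y where "y = snd \<circ> u"
  have ty: "t \<longlonglongrightarrow> fst p" "y \<longlonglongrightarrow> snd p"
    using tendsto_fst[OF u(3)] tendsto_snd[OF u(3)] by (simp_all add: t_def y_def o_def)
  have "\<exists>x a b. state x a b \<and> y n = enc x a b" for n
  proof -
    have "y n \<in> universe" using u(1) by (simp add: y_def mem_Times_iff)
    then show ?thesis unfolding universe_iff .
  qed
  then obtain x a b where xab: "\<And>n. state (x n) (a n) (b n)" "\<And>n. y n = enc (x n) (a n) (b n)" by metis
  have "(\<lambda>n. flow (t n) (y n)) \<longlonglongrightarrow> flow (fst p) (snd p)"
  proof (rule topological_tendstoI, rule ccontr)
    fix S assume S: "open S" "flow (fst p) (snd p) \<in> S"
      and "\<not> (\<forall>\<^sub>F n in sequentially. flow (t n) (y n) \<in> S)"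
    then obtain \<rho> where \<rho>: "strict_mono (\<rho> :: nat \<Rightarrow> nat)" "\<And>n. flow (t (\<rho> n)) (y (\<rho> n)) \<notin> S"
      using not_eventually_sequentiallyD by blast
    from states_compact[where x = "\<lambda>n. x (\<rho> n)", OF xab(1)] obtain r x' a' b' where
      r: "strict_mono (r :: nat \<Rightarrow> nat)" "state x' a' b'"
      "(\<lambda>n. a (\<rho> (r n))) \<longlonglongrightarrow> a'" "(\<lambda>n. b (\<rho> (r n))) \<longlonglongrightarrow> b'"
      "a' \<noteq> \<infinity> \<Longrightarrow> b' \<noteq> -\<infinity> \<Longrightarrow> (\<lambda>n. x (\<rho> (r n))) \<longlonglongrightarrow> x'" by metis
    have sm: "strict_mono (\<rho> \<circ> r)" using \<rho>(1) r(1) by (rule strict_mono_o)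
    have lims: "(\<lambda>n. t (\<rho> (r n))) \<longlonglongrightarrow> fst p" "(\<lambda>n. y (\<rho> (r n))) \<longlonglongrightarrow> snd p"
      using LIMSEQ_subseq_LIMSEQ[OF ty(1) sm] LIMSEQ_subseq_LIMSEQ[OF ty(2) sm] by (simp_all add: o_def)
    have "(\<lambda>n. y (\<rho> (r n))) \<longlonglongrightarrow> enc x' a' b'"
      unfolding xab(2) by (rule tendsto_enc[OF xab(1) r(2-5)])
    then have "snd p = enc x' a' b'" using lims(2) LIMSEQ_unique by blast
    then have "(\<lambda>n. flow (t (\<rho> (r n))) (y (\<rho> (r n)))) \<longlonglongrightarrow> flow (fst p) (snd p)"
      using tendsto_flow[OF xab(1) r(2-5) lims(1)] by (simp add: xab(2))
    then have "\<forall>\<^sub>F n in sequentially. flow (t (\<rho> (r n))) (y (\<rho> (r n))) \<in> S"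
      using S by (auto intro: topological_tendstoD)
    then show False using \<rho>(2) by simp
  qed
  then show "(\<lambda>n. case u n of (t, y) \<Rightarrow> flow t y) \<longlonglongrightarrow> (case p of (t, y) \<Rightarrow> flow t y)"
    by (simp add: t_def y_def case_prod_beta)
qed

lemma is_flow_universe: "is_flow universe flow"
proof -
  have "(\<lambda>s. s - t) ` UNIV = (UNIV :: real set)" for t :: real
    by (metis diff_add_cancel add_diff_cancel surj_def)
  then show ?thesis
    unfolding is_flow_def partial_flow_def dom_at_def
    using continuous_on_flow flow_in_universe flow_zero flow_plus by auto
qed

end

section \<open>The isolating universe\<close>

lemma tends_to_set_limit:
  assumes "tends_to_set f A F" "(f \<longlongrightarrow> l) F" "F \<noteq> bot" "closed A"
  shows "l \<in> A"
proof -
  have "\<exists>y\<in>A. dist y l < e" if "e > 0" for e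
  proof -
    have e2: "0 < e/2" using that by simp
    then have "\<forall>\<^sub>F t in F. \<exists>y\<in>A. dist (f t) y < e/2" using assms(1) unfolding tends_to_set_def by blast
    then have "\<forall>\<^sub>F t in F. (\<exists>y\<in>A. dist (f t) y < e/2) \<and> dist (f t) l < e/2"
      using tendstoD[OF assms(2) e2] by (rule eventually_conj)
    then have "\<exists>t. (\<exists>y\<in>A. dist (f t) y < e/2) \<and> dist (f t) l < e/2"
      using assms(3) eventually_happens by blast
    then obtain t y where "y \<in> A" "dist (f t) y < e/2" "dist (f t) l < e/2" by blast
    then show ?thesis using dist_triangle_half_r by blast
  qed
  then have "l \<in> closure A" by (simp add: closure_approachable)
  then show ?thesis using assms(4) by simp
qed

lemma rev_dom_UNIV: "rev_dom (UNIV \<times> Y) = UNIV \<times> Y"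
proof -
  have "(- (- t), y) \<in> rev_dom (UNIV \<times> Y)" if "y \<in> Y" for t y
    unfolding rev_dom_def using that by blast
  then show ?thesis by (auto simp: rev_dom_def)
qed

lemma attractor_top_level_set:
  fixes g :: "'a::metric_space \<Rightarrow> real"
  assumes Y: "compact Y" and g: "continuous_on Y g"
    and inY: "\<And>t y. y \<in> Y \<Longrightarrow> \<psi> t y \<in> Y"
    and inv: "\<And>t y. y \<in> Y \<Longrightarrow> g y = 1 \<Longrightarrow> g (\<psi> t y) = 1"
    and esc: "\<And>y. y \<in> Y \<Longrightarrow> g y \<noteq> 1 \<Longrightarrow> \<exists>t<0. g (\<psi> t y) < 0"
  shows "attractor Y (UNIV \<times> Y) \<psi> {y \<in> Y. g y = 1}"
proof -
  let ?N = "{y \<in> Y. g y \<ge> 0}"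
  have dom: "dom_at (UNIV \<times> Y) y = UNIV" if "y \<in> Y" for y
    using that by (auto simp: dom_at_def)
  have "closedin (top_of_set Y) (Y \<inter> g -` {0..})" using g by (rule continuous_closedin_preimage) simp
  moreover have "Y \<inter> g -` {0..} = ?N" by auto
  ultimately have cN: "compact ?N" using Y closedin_compact by metis
  have "openin (top_of_set Y) (Y \<inter> g -` {0<..})" using g by (rule continuous_openin_preimage_gen) simp
  then have op: "\<exists>U. openin (top_of_set Y) U \<and> {y \<in> Y. g y = 1} \<subseteq> U \<and> U \<subseteq> ?N"
    by (intro exI[where x = "Y \<inter> g -` {0<..}"]) auto
  have "y \<in> {y \<in> Y. g y = 1}" if "y \<in> Y" "\<forall>t\<in>dom_at (UNIV \<times> Y) y. \<psi> t y \<in> ?N" for y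
    using that esc[of y] by (auto simp: dom dest: not_le_imp_less) (meson not_less)
  then have "isolating_nbhd Y (UNIV \<times> Y) \<psi> {y \<in> Y. g y = 1} ?N"
    unfolding isolating_nbhd_def using cN op by blast
  moreover have "\<exists>t\<in>dom_at (UNIV \<times> Y) y. t < 0 \<and> \<psi> t y \<notin> ?N"
    if "y \<in> ?N - {y \<in> Y. g y = 1}" for y
  proof -
    have y: "y \<in> Y" "g y \<noteq> 1" using that by auto
    then obtain t where "t < 0" "g (\<psi> t y) < 0" using esc by blast
    then show ?thesis using y by (auto simp: dom intro!: exI[where x = t])
  qed
  moreover have "invariant_set Y (UNIV \<times> Y) \<psi> {y \<in> Y. g y = 1}"
    unfolding invariant_set_def using inv inY by auto
  ultimately show ?thesis unfolding attractor_def by blast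
qed

lemma ereal_minus_at_top: "c \<noteq> \<infinity> \<Longrightarrow> ((\<lambda>t. c - ereal t) \<longlongrightarrow> -\<infinity>) at_top"
proof (cases c)
  case (real r)
  have "\<forall>\<^sub>F t in at_top. r - t < u" for u
    using eventually_gt_at_top[of "r - u"] by eventually_elim simp
  then show ?thesis using real by (simp add: tendsto_MInfty)
qed auto

lemma ereal_minus_at_bot: "c \<noteq> -\<infinity> \<Longrightarrow> ((\<lambda>t. c - ereal t) \<longlongrightarrow> \<infinity>) at_bot"
proof (cases c)
  case (real r)
  have "\<forall>\<^sub>F t in at_bot. u < r - t" for u
    using eventually_gt_at_bot[of "r - u"] by eventually_elim simp
  then show ?thesis using real by (simp add: tendsto_PInfty)
qed auto

context separated_system
begin

definition embed :: "'a \<Rightarrow> nat \<Rightarrow> real" where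
  "embed x = enc x (- exit_time (-1) x) (exit_time 1 x)"

definition source :: "nat \<Rightarrow> real" where "source = enc undefined \<infinity> \<infinity>"

definition sink :: "nat \<Rightarrow> real" where "sink = enc undefined (-\<infinity>) (-\<infinity>)"

lemma enc_coords [simp]: "enc x a b 0 = squash a" "enc x a b (Suc 0) = squash b"
  by (simp_all add: enc_def)

lemma exit_time_interval: "- exit_time (-1) x \<le> ereal 0" "ereal 0 \<le> exit_time 1 x"
  using exit_time_nonneg[of 1 x] exit_time_nonneg[of "-1" x]
  unfolding zero_ereal_def[symmetric] by auto

lemma clamp_exit_time_0: "clamp_time (- exit_time (-1) x) (exit_time 1 x) 0 = 0"
  using exit_time_interval by (rule clamp_time_id)

lemma state_embed:
  assumes "x \<in> K" shows "state x (- exit_time (-1) x) (exit_time 1 x)"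
  unfolding state_def clamp_exit_time_0
proof (intro conjI allI impI)
  show "- exit_time (-1) x \<le> exit_time 1 x" using exit_time_interval order_trans by blast
  fix s assume s: "- exit_time (-1) x \<le> ereal (0 + s)" "ereal (0 + s) \<le> exit_time 1 x"
  show "(s, x) \<in> \<Gamma>" "\<phi> s x \<in> K"
  proof -
    have "(s, x) \<in> \<Gamma> \<and> \<phi> s x \<in> K"
    proof (cases "0 \<le> s")
      case True
      then show ?thesis using exit_time_stays[OF assms, of s 1] s by simp
    next
      case False
      then show ?thesis using exit_time_stays[OF assms, of "- s" "-1"] s
        by (simp add: ereal_uminus_le_reorder)
    qed
    then show "(s, x) \<in> \<Gamma>" "\<phi> s x \<in> K" by auto
  qed
qed

lemma continuous_on_embed: "continuous_on K embed"
proof (rule continuous_on_sequentiallyI)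
  fix f x assume f: "\<forall>n. f n \<in> K" "x \<in> K" "f \<longlonglongrightarrow> x"
  have "(\<lambda>n. exit_time \<sigma> (f n)) \<longlonglongrightarrow> exit_time \<sigma> x" for \<sigma>
    using continuous_on_tendsto_compose[OF continuous_on_exit_time f(3,2)] f(1) by simp
  then show "(\<lambda>n. embed (f n)) \<longlonglongrightarrow> embed x" unfolding embed_def
    using f by (intro tendsto_enc state_embed tendsto_uminus_ereal) auto
qed

lemma embed_inj: "inj_on embed K"
proof (rule inj_onI)
  fix x y assume xy: "x \<in> K" "y \<in> K" "embed x = embed y"
  have fin: "- exit_time (-1) x \<noteq> \<infinity>" "exit_time 1 x \<noteq> -\<infinity>"
    using exit_time_interval[of x] by auto
  show "x = y"
    by (rule enc_eqD(3)[OF xy(3)[unfolded embed_def] state_embed[OF xy(1)] state_embed[OF xy(2)] fin])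
qed

lemma embed_flow:
  assumes dom: "{min 0 t..max 0 t} \<subseteq> dom_at \<Gamma> x"
    and stay: "\<forall>s\<in>{min 0 t..max 0 t}. \<phi> s x \<in> N"
  shows "embed (\<phi> t x) = flow t (embed x)"
proof -
  have in0: "(s, x) \<in> \<Gamma> \<and> \<phi> s x \<in> N" if "min 0 t \<le> s" "s \<le> max 0 t" for s
  proof -
    have "s \<in> {min 0 t..max 0 t}" using that by simp
    then show ?thesis using dom stay dom_iff by blast
  qed
  have t: "(t, x) \<in> \<Gamma>" and x: "x \<in> K"
    using in0[of t] in0[of 0] N_subset dom_subset by (auto simp: subset_iff)
  define \<sigma> where "\<sigma> = (if 0 \<le> t then 1 else -1 :: real)"
  have \<sigma>: "\<sigma> * \<bar>t\<bar> = t" by (simp add: \<sigma>_def)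
  have E1: "exit_time \<sigma> x = ereal \<bar>t\<bar> + exit_time \<sigma> (\<phi> t x)"
    using exit_time_shift[of "\<bar>t\<bar>" \<sigma> x] in0 by (auto simp: \<sigma>) (auto simp: \<sigma>_def)
  have "(- \<sigma> * s, \<phi> t x) \<in> \<Gamma> \<and> \<phi> (- \<sigma> * s) (\<phi> t x) \<in> N" if "0 \<le> s" "s \<le> \<bar>t\<bar>" for s
  proof -
    have "(- \<sigma> * s + t, x) \<in> \<Gamma> \<and> \<phi> (- \<sigma> * s + t) x \<in> N"
      using that by (intro in0) (auto simp: \<sigma>_def min_def max_def)
    then show ?thesis using t dom_flow_iff flow_add by metis
  qed
  then have "exit_time (- \<sigma>) (\<phi> t x) = ereal \<bar>t\<bar> + exit_time (- \<sigma>) (\<phi> (- \<sigma> * \<bar>t\<bar>) (\<phi> t x))"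
    by (intro exit_time_shift) auto
  then have E2: "exit_time (- \<sigma>) (\<phi> t x) = ereal \<bar>t\<bar> + exit_time (- \<sigma>) x"
    using \<sigma> flow_inverse[OF t] by simp
  have "exit_time 1 x - ereal t = exit_time 1 (\<phi> t x) \<and>
      - exit_time (-1) x - ereal t = - exit_time (-1) (\<phi> t x)"
  proof -
    have fwd: "u - ereal r = v" "- v - ereal r = - u" if "u = ereal r + v" for u v r
      using that by (cases v; simp)+
    have bwd: "v - ereal (- r) = u" "- u - ereal (- r) = - v" if "u = ereal r + v" for u v r
      using that by (cases v; simp)+
    show ?thesis
    proof (cases "0 \<le> t")
      case True
      then show ?thesis using fwd(1)[OF E1] fwd(2)[OF E2] by (simp add: \<sigma>_def)
    next
      case False
      then show ?thesis using bwd(1)[OF E2] bwd(2)[OF E1] by (simp add: \<sigma>_def)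
    qed
  qed
  then have ex: "exit_time 1 x - ereal t = exit_time 1 (\<phi> t x)"
      "- exit_time (-1) x - ereal t = - exit_time (-1) (\<phi> t x)" by auto
  have "- exit_time (-1) x \<le> ereal t" "ereal t \<le> exit_time 1 x"
    using exit_time_interval[of x] exit_time_interval[of "\<phi> t x"] unfolding ex[symmetric]
    by (cases "exit_time 1 x"; cases "exit_time (-1) x"; simp)+
  then have "clamp_time (- exit_time (-1) x) (exit_time 1 x) t = t" by (rule clamp_time_id)
  then show ?thesis
    unfolding embed_def flow_enc[OF state_embed[OF x]] ex shift_pos_def clamp_exit_time_0 by simp
qed

lemma L_subset_N: "L \<subseteq> N"
  using isolN unfolding isolating_nbhd_def by blast

lemma exit_time_L: "x \<in> L \<Longrightarrow> exit_time \<sigma> x = \<infinity>"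
proof -
  assume x: "x \<in> L"
  have "G (\<phi> s x) = \<infinity>" if "(s, x) \<in> \<Gamma>" for s
    using inv x that L_subset_N G_N unfolding invariant_set_def dom_at_def by blast
  then have "\<infinity> \<le> exit_time \<sigma> x" unfolding exit_time_def by (intro INF_greatest) simp
  then show ?thesis by simp
qed

lemma embed_L: "embed ` L = {y \<in> universe. y 0 = -1 \<and> y 1 = 1}"
proof safe
  fix x assume "x \<in> L"
  then have "embed x = enc x (-\<infinity>) \<infinity>" "x \<in> K"
    using L_subset_N N_subset by (auto simp: embed_def exit_time_L)
  then show "embed x 0 = -1" "embed x 1 = 1" by simp_all
  show "embed x \<in> universe"
    unfolding embed_def using \<open>x \<in> K\<close> by (intro enc_in_universe state_embed)
next
  fix y assume y: "y \<in> universe" "y 0 = -1" "y 1 = 1"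
  then obtain x a b where st: "state x a b" and y': "y = enc x a b" by (elim universeE)
  have "squash a = squash (-\<infinity>)" "squash b = squash \<infinity>" using y y' by auto
  then have ab: "a = -\<infinity>" "b = \<infinity>" by (simp_all only: squash_eq_iff)
  have "(s, x) \<in> \<Gamma> \<and> \<phi> s x \<in> K" for s using st unfolding ab state_def by simp
  then have "x \<in> L" using isol dom_subset unfolding isolating_nbhd_def by blast
  moreover from this have "embed x = y" by (simp add: embed_def exit_time_L y' ab)
  ultimately show "y \<in> embed ` L" by blast
qed

lemma embed_L_coords:
  assumes "x \<in> L"
  shows "embed x \<in> universe" "embed x 0 = -1" "embed x (Suc 0) = 1"
proof -
  have "embed x \<in> embed ` L" using assms by blast
  then show "embed x \<in> universe" "embed x 0 = -1" "embed x (Suc 0) = 1"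
    unfolding embed_L by simp_all
qed

lemma continuous_on_coordinate: "continuous_on S (\<lambda>y :: nat \<Rightarrow> real. y k)"
  by (rule continuous_on_subset[OF continuous_on_product_coordinates]) simp

lemma closed_embed_L: "closed (embed ` L)"
proof -
  have "closed {y :: nat \<Rightarrow> real. y k = c}" for k c
    using continuous_on_coordinate by (intro closed_Collect_eq continuous_intros) auto
  moreover have "embed ` L = universe \<inter> ({y. y 0 = -1} \<inter> {y. y 1 = 1})"
    unfolding embed_L by auto
  ultimately show ?thesis using compact_imp_closed[OF compact_universe] by auto
qed

lemma near_embed_L:
  assumes e: "e > 0"
  shows "\<exists>M. \<forall>x a b. state x a b \<longrightarrow> a < ereal (- M) \<longrightarrow> ereal M < b \<longrightarrow> (\<exists>y\<in>embed ` L. dist (enc x a b) y < e)"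
proof (rule ccontr)
  assume "\<not> ?thesis"
  then have "\<forall>M. \<exists>x a b. state x a b \<and> a < ereal (- M) \<and> ereal M < b \<and>
      \<not> (\<exists>y\<in>embed ` L. dist (enc x a b) y < e)" by simp
  then have "\<forall>n::nat. \<exists>x a b. state x a b \<and> a < ereal (- real n) \<and> ereal (real n) < b \<and>
      (\<forall>y\<in>embed ` L. \<not> dist (enc x a b) y < e)" by simp
  then obtain x a b where st: "\<And>n::nat. state (x n) (a n) (b n)"
    and ab: "\<And>n. a n < ereal (- real n)" "\<And>n. ereal (real n) < b n"
    and far: "\<And>n y. y \<in> embed ` L \<Longrightarrow> \<not> dist (enc (x n) (a n) (b n)) y < e" by metis
  from states_compact[where x = x, OF st] obtain r x' a' b' where
    r: "strict_mono (r :: nat \<Rightarrow> nat)" "state x' a' b'"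
    "(\<lambda>n. a (r n)) \<longlonglongrightarrow> a'" "(\<lambda>n. b (r n)) \<longlonglongrightarrow> b'"
    "a' \<noteq> \<infinity> \<Longrightarrow> b' \<noteq> -\<infinity> \<Longrightarrow> (\<lambda>n. x (r n)) \<longlonglongrightarrow> x'" by metis
  have rn: "n \<le> r n" for n using r(1) by (rule seq_suble)
  have bd: "a' \<le> ereal (- real m)" "ereal (real m) \<le> b'" for m
  proof -
    have "a (r n) \<le> ereal (- real m) \<and> ereal (real m) \<le> b (r n)" if "m \<le> n" for n
    proof -
      have "ereal (- real (r n)) \<le> ereal (- real m)" "ereal (real m) \<le> ereal (real (r n))"
        using rn[of n] that by simp_all
      then show ?thesis using ab[of "r n"] by (meson less_imp_le order_trans)
    qed
    then show "a' \<le> ereal (- real m)" "ereal (real m) \<le> b'"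
      using LIMSEQ_le_const2[OF r(3)] LIMSEQ_le_const[OF r(4)] by blast+
  qed
  have "a' = -\<infinity>"
  proof (rule ereal_bot)
    fix B obtain m where "- B < real m" using reals_Archimedean2 by blast
    then have "ereal (- real m) \<le> ereal B" by simp
    then show "a' \<le> ereal B" using bd(1) order_trans by blast
  qed
  moreover have "b' = \<infinity>"
  proof (rule ereal_top)
    fix B obtain m where "B < real m" using reals_Archimedean2 by blast
    then have "ereal B \<le> ereal (real m)" by simp
    then show "ereal B \<le> b'" using bd(2) order_trans by blast
  qed
  ultimately have "enc x' a' b' \<in> embed ` L" using r(2) by (auto simp: embed_L enc_in_universe)
  moreover have "(\<lambda>n. enc (x (r n)) (a (r n)) (b (r n))) \<longlonglongrightarrow> enc x' a' b'"
    by (rule tendsto_enc[OF st r(2-5)])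
  from eventually_happens'[OF sequentially_bot tendstoD[OF this e]]
  have "\<exists>n. dist (enc (x (r n)) (a (r n)) (b (r n))) (enc x' a' b') < e" .
  ultimately show False using far by blast
qed

lemma tends_to_embed_L:
  assumes st: "state x a b"
    and a: "((\<lambda>t. a - ereal t) \<longlongrightarrow> -\<infinity>) F" and b: "((\<lambda>t. b - ereal t) \<longlongrightarrow> \<infinity>) F"
  shows "tends_to_set (\<lambda>t. flow t (enc x a b)) (embed ` L) F"
  unfolding tends_to_set_def
proof (intro allI impI)
  fix e :: real assume "e > 0"
  obtain M where M: "\<And>x a b. state x a b \<Longrightarrow> a < ereal (- M) \<Longrightarrow> ereal M < b \<Longrightarrow>
      \<exists>y\<in>embed ` L. dist (enc x a b) y < e" using near_embed_L[OF \<open>e > 0\<close>] by auto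
  have "\<forall>\<^sub>F t in F. a - ereal t < ereal (- M)" using a unfolding tendsto_MInfty by blast
  moreover have "\<forall>\<^sub>F t in F. ereal M < b - ereal t" using b unfolding tendsto_PInfty by blast
  ultimately show "\<forall>\<^sub>F t in F. \<exists>y\<in>embed ` L. dist (flow t (enc x a b)) y < e"
    unfolding flow_enc[OF st] by eventually_elim (rule M[OF state_shift[OF st]])
qed

lemma tendsto_sink:
  assumes st: "state x a b" and b: "b \<noteq> \<infinity>"
  shows "((\<lambda>t. flow t (enc x a b)) \<longlongrightarrow> sink) at_top"
proof -
  have "a \<noteq> \<infinity>" using state_le[OF st] b by auto
  then show ?thesis unfolding flow_enc[OF st] sink_def
    using b by (intro tendsto_enc[OF state_shift[OF st] state_infinite(2)] ereal_minus_at_top) auto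
qed

lemma tendsto_source:
  assumes st: "state x a b" and a: "a \<noteq> -\<infinity>"
  shows "((\<lambda>t. flow t (enc x a b)) \<longlongrightarrow> source) at_bot"
proof -
  have "b \<noteq> -\<infinity>" using state_le[OF st] a by auto
  then show ?thesis unfolding flow_enc[OF st] source_def
    using a by (intro tendsto_enc[OF state_shift[OF st] state_infinite(1)] ereal_minus_at_bot) auto
qed

lemma source_sink:
  "source \<in> universe" "sink \<in> universe" "source \<noteq> sink"
  "flow t source = source" "flow t sink = sink"
proof -
  show "source \<in> universe" "sink \<in> universe"
    unfolding source_def sink_def by (intro enc_in_universe state_infinite)+
  have "source 0 \<noteq> sink 0" by (simp add: source_def sink_def)
  then show "source \<noteq> sink" by auto
  show "flow t source = source" "flow t sink = sink"
    unfolding source_def sink_def flow_enc[OF state_infinite(1)] flow_enc[OF state_infinite(2)]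
    by simp_all (rule enc_infinite)+
qed

lemma source_sink_notin: "source \<notin> embed ` N" "sink \<notin> embed ` N"
proof -
  have bd: "\<not> squash 0 < embed x 0" "\<not> embed x 1 < squash 0" for x
    unfolding embed_def by (simp_all add: not_less exit_time_nonneg del: squash_0)
  have "source 0 = 1" "sink 1 = -1" by (simp_all add: source_def sink_def)
  then have "source 0 \<noteq> embed x 0" "sink 1 \<noteq> embed x 1" for x
    using bd[of x] by auto
  then show "source \<notin> embed ` N" "sink \<notin> embed ` N" by (metis imageE)+
qed

lemma stable_part:
  "{source} \<union> embed ` L \<union> stable_set universe flow (embed ` L) = {y \<in> universe. y 1 = 1}"
proof safe
  fix y assume y: "y \<in> stable_set universe flow (embed ` L)"
  then show "y \<in> universe" by (simp add: stable_set_def)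
  then obtain x a b where st: "state x a b" and y': "y = enc x a b" by (elim universeE)
  have "b = \<infinity>"
  proof (rule ccontr)
    assume "b \<noteq> \<infinity>"
    then have "sink \<in> embed ` L"
      using y tendsto_sink[OF st] closed_embed_L unfolding stable_set_def y'
      by (auto intro: tends_to_set_limit)
    then show False using L_subset_N source_sink_notin by blast
  qed
  then show "y 1 = 1" by (simp add: y')
next
  fix y assume y: "y \<in> universe" "y 1 = 1" "y \<notin> stable_set universe flow (embed ` L)" "y \<notin> embed ` L"
  then obtain x a b where st: "state x a b" and y': "y = enc x a b" by (elim universeE)
  have "squash b = squash \<infinity>" using y y' by auto
  then have b: "b = \<infinity>" by (simp only: squash_eq_iff)
  have "a = \<infinity>"
  proof (rule ccontr)
    assume "a \<noteq> \<infinity>"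
    then have "tends_to_set (\<lambda>t. flow t y) (embed ` L) at_top"
      unfolding y' using st b by (intro tends_to_embed_L ereal_minus_at_top) auto
    then show False using y by (simp add: stable_set_def)
  qed
  then show "y = source" unfolding y' b source_def by (simp only:) (rule enc_infinite)
qed (simp_all add: source_sink embed_L_coords, simp add: source_def)

lemma unstable_part:
  "{sink} \<union> embed ` L \<union> unstable_set universe flow (embed ` L) = {y \<in> universe. - y 0 = 1}"
proof safe
  fix y assume y: "y \<in> unstable_set universe flow (embed ` L)"
  then show "y \<in> universe" by (simp add: unstable_set_def)
  then obtain x a b where st: "state x a b" and y': "y = enc x a b" by (elim universeE)
  have "a = -\<infinity>"
  proof (rule ccontr)
    assume "a \<noteq> -\<infinity>"
    then have "source \<in> embed ` L"
      using y tendsto_source[OF st] closed_embed_L unfolding unstable_set_def y'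
      by (auto intro: tends_to_set_limit)
    then show False using L_subset_N source_sink_notin by blast
  qed
  then show "- y 0 = 1" by (simp add: y')
next
  fix y assume y: "y \<in> universe" "- y 0 = 1" "y \<notin> unstable_set universe flow (embed ` L)" "y \<notin> embed ` L"
  then obtain x a b where st: "state x a b" and y': "y = enc x a b" by (elim universeE)
  have "squash a = squash (-\<infinity>)" using y y' by auto
  then have a: "a = -\<infinity>" by (simp only: squash_eq_iff)
  have "b = -\<infinity>"
  proof (rule ccontr)
    assume "b \<noteq> -\<infinity>"
    then have "tends_to_set (\<lambda>t. flow t y) (embed ` L) at_bot"
      unfolding y' using st a by (intro tends_to_embed_L ereal_minus_at_bot) auto
    then show False using y by (simp add: unstable_set_def)
  qed
  then show "y = sink" unfolding y' a sink_def by (simp only:) (rule enc_infinite)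
qed (simp_all add: source_sink embed_L_coords, simp add: sink_def)

lemma isolating_universe_embed: "isolating_universe X \<Gamma> \<phi> L N universe flow embed source sink"
proof -
  have N: "compact N" using isolN unfolding isolating_nbhd_def by blast
  have "\<exists>g. homeomorphism N (embed ` N) embed g"
    using N continuous_on_subset[OF continuous_on_embed N_subset] inj_on_subset[OF embed_inj N_subset]
    by (intro homeomorphism_compact) auto
  moreover have "embed ` N \<subseteq> universe"
    using N_subset by (auto simp: embed_def intro!: enc_in_universe state_embed)
  moreover have "tends_to_set (\<lambda>t. flow t y) (embed ` L) at_top \<or> ((\<lambda>t. flow t y) \<longlongrightarrow> sink) at_top"
    if "y \<in> universe" "y \<noteq> source" for y
  proof -
    obtain x a b where st: "state x a b" and y: "y = enc x a b" using \<open>y \<in> universe\<close> by (elim universeE)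
    have "a \<noteq> \<infinity>" if "b = \<infinity>" using \<open>y \<noteq> source\<close> that enc_infinite unfolding y source_def by metis
    then show ?thesis
      using tendsto_sink[OF st] y st
      by (cases "b = \<infinity>") (auto intro!: tends_to_embed_L ereal_minus_at_top)
  qed
  moreover have "tends_to_set (\<lambda>t. flow t y) (embed ` L) at_bot \<or> ((\<lambda>t. flow t y) \<longlongrightarrow> source) at_bot"
    if "y \<in> universe" "y \<noteq> sink" for y
  proof -
    obtain x a b where st: "state x a b" and y: "y = enc x a b" using \<open>y \<in> universe\<close> by (elim universeE)
    have "b \<noteq> -\<infinity>" if "a = -\<infinity>" using \<open>y \<noteq> sink\<close> that enc_infinite unfolding y sink_def by metis
    then show ?thesis
      using tendsto_source[OF st] y st
      by (cases "a = -\<infinity>") (auto intro!: tends_to_embed_L ereal_minus_at_bot)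
  qed
  ultimately show ?thesis
    unfolding isolating_universe_def
    using compact_universe is_flow_universe embed_flow source_sink source_sink_notin by blast
qed

lemma repeller_stable_part:
  "repeller universe (UNIV \<times> universe) flow
     ({source} \<union> embed ` L \<union> stable_set universe flow (embed ` L))"
  unfolding stable_part repeller_def rev_dom_UNIV
proof (rule attractor_top_level_set)
  fix y t assume "y \<in> universe"
  then obtain x a b where st: "state x a b" and y: "y = enc x a b" by (elim universeE)
  have b: "squash b = 1 \<longleftrightarrow> b = \<infinity>" using squash_eq_iff[of b \<infinity>] by simp
  have fl: "rev_flow flow t y 1 = squash (b - ereal (- t))" for t
    by (simp add: rev_flow_def y flow_enc[OF st])
  show "y 1 = 1 \<Longrightarrow> rev_flow flow t y 1 = 1" using b unfolding fl by (simp add: y)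
  assume "y 1 \<noteq> 1"
  then have "b \<noteq> \<infinity>" by (simp add: y b)
  then consider r where "b = ereal r" | "b = -\<infinity>" by (cases b) auto
  then show "\<exists>t<0. rev_flow flow t y 1 < 0"
  proof cases
    case 1
    have "rev_flow flow (- \<bar>r\<bar> - 1) y 1 < squash 0"
      unfolding fl 1 squash_less_iff by simp
    then show ?thesis by (intro exI[where x = "- \<bar>r\<bar> - 1"]) simp
  next
    case 2
    then show ?thesis unfolding fl by (intro exI[where x = "-1"]) simp
  qed
qed (auto simp: rev_flow_def compact_universe continuous_on_coordinate flow_zero intro: flow_in_universe)

lemma attractor_unstable_part:
  "attractor universe (UNIV \<times> universe) flow
     ({sink} \<union> embed ` L \<union> unstable_set universe flow (embed ` L))"
  unfolding unstable_part
proof (rule attractor_top_level_set)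
  fix y t assume "y \<in> universe"
  then obtain x a b where st: "state x a b" and y: "y = enc x a b" by (elim universeE)
  have a: "- squash a = 1 \<longleftrightarrow> a = -\<infinity>" using squash_eq_iff[of a "-\<infinity>"] by auto
  have fl: "flow t y 0 = squash (a - ereal t)" for t
    by (simp add: y flow_enc[OF st])
  show "- y 0 = 1 \<Longrightarrow> - flow t y 0 = 1" using a unfolding fl by (simp add: y)
  assume "- y 0 \<noteq> 1"
  then have "a \<noteq> -\<infinity>" using a by (simp add: y)
  then consider r where "a = ereal r" | "a = \<infinity>" by (cases a) auto
  then show "\<exists>t<0. - flow t y 0 < 0"
  proof cases
    case 1
    have "squash 0 < flow (- \<bar>r\<bar> - 1) y 0"
      unfolding fl 1 squash_less_iff by simp
    then show ?thesis by (intro exI[where x = "- \<bar>r\<bar> - 1"]) simp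
  next
    case 2
    then show ?thesis unfolding fl by (intro exI[where x = "-1"]) simp
  qed
qed (auto simp: compact_universe continuous_on_coordinate flow_zero intro!: flow_in_universe continuous_intros)

end

context isolated_system
begin

lemma L_subset_K: "L \<subseteq> K"
  using isol unfolding isolating_nbhd_def by blast

lemma closed_L: "closed L"
  unfolding closed_sequential_limits
proof (intro allI impI)
  fix f x assume f: "(\<forall>n. f n \<in> L) \<and> f \<longlonglongrightarrow> x"
  have orbit: "(s, y) \<in> \<Gamma> \<and> \<phi> s y \<in> K" if "y \<in> L" for s y
  proof (rule stays_in_K)
    show "y \<in> K" using that L_subset_K by blast
    show "\<phi> (l * s) y \<in> K" if "(l * s, y) \<in> \<Gamma>" for l
      using inv \<open>y \<in> L\<close> that L_subset_K unfolding invariant_set_def dom_at_def by blast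
  qed
  have "(s, x) \<in> \<Gamma> \<and> \<phi> s x \<in> K" for s
  proof (rule limit_stays_in_K)
    show "f \<longlonglongrightarrow> x" using f by blast
    show "(\<lambda>_. s) \<longlonglongrightarrow> s" by (rule tendsto_const)
    show "(l * s, f n) \<in> \<Gamma> \<and> \<phi> (l * s) (f n) \<in> K" for n l using f by (intro orbit) blast
  qed
  then show "x \<in> L" using isol dom_subset unfolding isolating_nbhd_def by blast
qed

lemma separated_system_exists: "\<exists>N G q. separated_system X \<Gamma> \<phi> L K N G q"
proof -
  obtain U where U: "openin (top_of_set X) U" "L \<subseteq> U" "U \<subseteq> K"
    using isol unfolding isolating_nbhd_def by blast
  have "normal_space (top_of_set X)"
    by (intro metrizable_imp_normal_space metrizable_space_subtopology metrizable_space_euclidean)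
  moreover have "closedin (top_of_set X) L"
    using closed_L L_subset_K K_subset by (intro closed_subset) auto
  moreover have "closedin (top_of_set X) (X - U)" using U(1) by (intro closedin_diff) auto
  moreover have "disjnt L (X - U)" using U(2) by (auto simp: disjnt_def)
  ultimately obtain f where f: "continuous_map (top_of_set X) (top_of_set {0..1::real}) f"
    "f ` L \<subseteq> {0}" "f ` (X - U) \<subseteq> {1}"
    by (rule Urysohn_lemma[of _ _ _ 0 1]) simp
  have fc: "continuous_on X f" and f01: "\<And>x. x \<in> X \<Longrightarrow> f x \<in> {0..1}"
    using f(1) by (auto simp: continuous_map_in_subtopology)
  have fU: "x \<in> U" if "x \<in> X" "f x \<noteq> 1" for x using f(3) that by auto
  define N where "N = {x \<in> X. f x \<le> 1/2}"
  define v where "v = (\<lambda>x. max 0 (2 * f x - 1))"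
  define G where "G = (\<lambda>x. inverse (ereal (v x)) - 1)"
  have NK: "N \<subseteq> K" using fU U(3) by (force simp: N_def)
  have v: "0 \<le> v x" "x \<in> X \<Longrightarrow> v x \<le> 1" for x using f01[of x] by (auto simp: v_def)
  obtain q :: "nat \<Rightarrow> 'a" where q: "\<And>x y. x \<in> K \<Longrightarrow> y \<in> K \<Longrightarrow> (\<And>k. dist x (q k) = dist y (q k)) \<Longrightarrow> x = y"
    using countable_separating_points[OF compact_K] by metis
  have "N = K \<inter> f -` {..1/2}" using NK K_subset by (auto simp: N_def)
  moreover have "closedin (top_of_set K) (K \<inter> f -` {..1/2})"
    using continuous_on_subset[OF fc K_subset] by (rule continuous_closedin_preimage) simp
  ultimately have "compact N" using compact_K closedin_compact by metis
  moreover have "openin (top_of_set X) (X \<inter> f -` {..<1/2})"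
    using fc by (rule continuous_openin_preimage_gen) simp
  then have "\<exists>U. openin (top_of_set X) U \<and> L \<subseteq> U \<and> U \<subseteq> N"
    using f(2) L_subset_K K_subset by (intro exI[where x = "X \<inter> f -` {..<1/2}"]) (auto simp: N_def)
  moreover have "x \<in> L" if "x \<in> X" "\<forall>t\<in>dom_at \<Gamma> x. \<phi> t x \<in> N" for x
    using isol that NK unfolding isolating_nbhd_def by blast
  ultimately have isolN: "isolating_nbhd X \<Gamma> \<phi> L N"
    unfolding isolating_nbhd_def by (auto simp: N_def)
  have "continuous_on X v" unfolding v_def by (intro continuous_intros fc)
  then have "continuous_on X (\<lambda>x. ereal (v x))" by (simp add: continuous_on_def)
  then have "continuous_on X (\<lambda>x. inverse (ereal (v x)))"
    by (rule continuous_on_compose2[OF continuous_on_inverse_ereal]) (auto simp: v(1))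
  then have Gc: "continuous_on X G"
    unfolding G_def continuous_on_def
    by (intro ballI tendsto_diff_ereal_general tendsto_const) (blast, simp)
  have G0: "0 \<le> G x" if "x \<in> X" for x
  proof (cases "v x = 0")
    case True
    then show ?thesis by (simp add: G_def)
  next
    case False
    then have "G x = ereal (inverse (v x) - 1)" by (simp add: G_def one_ereal_def)
    moreover have "1 \<le> inverse (v x)" using False v[of x] that by (simp add: one_le_inverse)
    ultimately show ?thesis by simp
  qed
  have GN: "G x = \<infinity>" if "x \<in> N" for x using that by (simp add: G_def v_def N_def)
  have GK: "G x = 0" if "x \<in> X" "x \<notin> K" for x
  proof -
    have "f x = 1" using fU U(3) that by blast
    then show ?thesis by (simp add: G_def v_def one_ereal_def)
  qed
  have "separated_system X \<Gamma> \<phi> L K N G q"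
    by unfold_locales (use isolN NK Gc G0 GN GK q in auto)
  then show ?thesis by blast
qed

end

theorem mainTheorem1:
  fixes X :: "'a::metric_space set"
    and \<Gamma> :: "(real \<times> 'a) set"
    and \<phi> :: "real \<Rightarrow> 'a \<Rightarrow> 'a"
    and L :: "'a set"
  assumes "partial_flow X \<Gamma> \<phi>"
    and "isolated_set X \<Gamma> \<phi> L"
  shows "\<exists>N (Y :: (nat \<Rightarrow> real) set) \<psi> h \<alpha> \<omega>.
           isolating_nbhd X \<Gamma> \<phi> L N \<and>
           isolating_universe X \<Gamma> \<phi> L N Y \<psi> h \<alpha> \<omega> \<and>
           repeller Y (UNIV \<times> Y) \<psi> ({\<alpha>} \<union> h ` L \<union> stable_set Y \<psi> (h ` L)) \<and>
           attractor Y (UNIV \<times> Y) \<psi> ({\<omega>} \<union> h ` L \<union> unstable_set Y \<psi> (h ` L)) \<and>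
           h ` L = ({\<alpha>} \<union> h ` L \<union> stable_set Y \<psi> (h ` L)) \<inter>
                   ({\<omega>} \<union> h ` L \<union> unstable_set Y \<psi> (h ` L))"
proof -
  obtain K where "isolated_system X \<Gamma> \<phi> L K"
    using assms unfolding isolated_set_def isolated_system_def by blast
  then obtain N G q where "separated_system X \<Gamma> \<phi> L K N G q"
    using isolated_system.separated_system_exists by blast
  then interpret separated_system X \<Gamma> \<phi> L K N G q .
  have "embed ` L = ({source} \<union> embed ` L \<union> stable_set universe flow (embed ` L)) \<inter>
      ({sink} \<union> embed ` L \<union> unstable_set universe flow (embed ` L))"
    unfolding stable_part unstable_part by (auto simp: embed_L)
  then show ?thesis
    using isolN isolating_universe_embed repeller_stable_part attractor_unstable_part by blast
qed

end
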